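(* Let $\mu$ be a doubling measure in $\mathbb{R}^d$ with connected support such that $$\liminf_{r\to 0}\beta_2^{(1)}(\mu,B_{\mathbb{R}^d}(x,r))>0\quad\text{and}\quad \underline{D}^{1}(\mu,x)>0\qquad\text{for }\mu\text{-a.e. }x.$$ Then $$\sum_{Q\ni x,\ \ell(Q)\leq 1}\frac{\operatorname{diam} Q}{\mu(Q)}<\infty\qquad\text{for }\mu\text{-a.e. }x,$$ where the sum is over all half-open dyadic cubes $Q\subseteq\mathbb{R}^d$ containing $x$ with side length $\ell(Q)\leq 1$.
   Context: $B_{\mathbb{R}^d}(x,r)$ is the open Euclidean ball with centre $x$ and radius $r$. A Borel measure $\mu$ on $\mathbb{R}^d$ is called doubling here if balls have finite measure and there is a constant $C_\mu>0$ with $\mu(B_{\mathbb{R}^d}(x,2r))\leq C_\mu\,\mu(B_{\mathbb{R}^d}(x,r))$ for all $x\in\operatorname{supp}\mu$ and all $r>0$ (that is, $\mu$ is a doubling measure on the metric space $\operatorname{supp}\mu$). For a bounded set $A$ with $\mu(A)>0$, $$\beta_2^{(1)}(\mu,A)^2=\inf_{L}\int_A\left(\frac{\operatorname{dist}(x,L)}{\operatorname{diam}A}\right)^2\frac{d\mu(x)}{\mu(A)},$$ where the infimum is over all lines $L\subseteq\mathbb{R}^d$. The lower $1$-density is $\underline{D}^{1}(\mu,x)=\liminf_{r\to0}\frac{\mu(B_{\mathbb{R}^d}(x,r))}{r}$. $\ell(Q)$ denotes the side length of a cube $Q$; half-open dyadic cubes are the sets $\prod_{i=1}^d[k_i2^{-n},(k_i+1)2^{-n})$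 with $k_i,n\in\mathbb{Z}$. *)

theory Defs
  imports "HOL-Analysis.Analysis"
begin

definition msupport :: "'a::metric_space measure \<Rightarrow> 'a set" where
  "msupport \<mu> = {x. \<forall>r>0. emeasure \<mu> (ball x r) > 0}"

definition doubling_measure :: "(real ^ 'n) measure \<Rightarrow> bool" where
  "doubling_measure \<mu> \<longleftrightarrow>
     sets \<mu> = sets borel \<and>
     (\<forall>x r. emeasure \<mu> (ball x r) < \<infinity>) \<and>
     (\<exists>C::real. C > 0 \<and>
        (\<forall>x\<in>msupport \<mu>. \<forall>r>0.
           emeasure \<mu> (ball x (2 * r)) \<le> ennreal C * emeasure \<mu> (ball x r)))"

(* Intended for bounded Borel sets A with 0 < \<mu>(A) < \<infinity>, where the integrand is bounded and
   the real-valued integral, quotient and infimum are the usual ones. *)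
definition beta2 :: "(real ^ 'n) measure \<Rightarrow> (real ^ 'n) set \<Rightarrow> real" where
  "beta2 \<mu> A =
     sqrt (INF L\<in>{L. affine L \<and> aff_dim L = 1}.
             (LINT x:A|\<mu>. (infdist x L / diameter A)\<^sup>2) / measure \<mu> A)"

definition lower_density1 :: "(real ^ 'n) measure \<Rightarrow> real ^ 'n \<Rightarrow> ennreal" where
  "lower_density1 \<mu> x = Liminf (at_right 0) (\<lambda>r. emeasure \<mu> (ball x r) / ennreal r)"

definition dyadic_cube :: "int \<Rightarrow> ('n \<Rightarrow> int) \<Rightarrow> (real ^ 'n) set" where
  "dyadic_cube n k =
     {x. \<forall>i. of_int (k i) * 2 powi (- n) \<le> x $ i \<and> x $ i < (of_int (k i) + 1) * 2 powi (- n)}"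

(* dyadic cubes containing x of side length 2 powi (- n) at most 1 *)
definition small_dyadic_cubes_at :: "real ^ 'n \<Rightarrow> (real ^ 'n) set set" where
  "small_dyadic_cubes_at x =
     {Q. \<exists>n k. Q = dyadic_cube n k \<and> (2::real) powi (- n) \<le> 1 \<and> x \<in> Q}"

end

theory Submission
  imports Defs
begin

text \<open>
  Let \<open>X\<close> be the support of \<open>\<mu>\<close>. Almost every point lies in one of countably many bounded sets
  \<open>E \<subseteq> X\<close> on which the hypotheses hold uniformly: for all \<open>x \<in> E\<close> and all small \<open>r\<close> the ball
  \<open>B(x,r)\<close> has mass at least \<open>c r\<close>, and \<open>X \<inter> B(x,r)\<close> is contained in no \<open>\<epsilon> r\<close>-neighbourhood of a
  line (otherwise the beta number would be at most \<open>\<epsilon>\<close>). Integrating the sum of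
  \<open>diam Q / \<mu>(Q)\<close> times the indicator of \<open>Q\<close>, over all \<open>Q\<close> that meet \<open>E\<close>, gives at most the sum of
  \<open>diam Q\<close>. So it is enough to bound the sum of \<open>2\<^sup>-\<^sup>n\<close> times the number of dyadic cubes of side
  \<open>2\<^sup>-\<^sup>n\<close> that meet \<open>E\<close>; this is lemma \<open>dyadic_count_summable\<close>.

  Suppose first that \<open>X\<close> were a curve of finite length. For a fixed vector \<open>e\<close>, the number of
  points of \<open>X\<close> on the hyperplane \<open>e \<bullet> x = t\<close>, integrated over \<open>t\<close>, is at most \<open>|e|\<close> times the
  length of \<open>X\<close>. Moreover, for a set of \<open>k\<close> points there are only \<open>O(k)\<close> pairs of a scale and a
  place such that two of the points are near the place, at a distance comparable to the scale
  (\<open>card_splitting_scales_le\<close>). Hence the estimate follows if every cube \<open>Q\<close> that meets \<open>E\<close> has its own set of levels \<open>t\<close>, of measure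
  comparable to the side of \<open>Q\<close>, on which the hyperplane contains two points of \<open>X\<close> near \<open>Q\<close>
  whose distance is comparable to the side of \<open>Q\<close>. Lemma \<open>nonflat_overlaps\<close> provides these levels,
  with \<open>e\<close> from a finite set that does not depend on \<open>Q\<close>; they exist because \<open>X\<close> is connected
  and, near \<open>Q\<close>, not close to a line.

  In general \<open>X\<close> may have infinite length away from \<open>E\<close>. It is therefore replaced by a finite
  subset \<open>S\<close> in which every point \<open>x\<close> stands for a ball of radius \<open>\<rho>(x)\<close>, a small multiple of the
  distance from \<open>x\<close> to \<open>E\<close>. Doubling transfers the lower mass bound from the nearest points of \<open>E\<close>
  to these balls, and they are disjoint after shrinking. Thus the sum of all \<open>\<rho>(x)\<close> is bounded by the
  mass of a bounded set, and this bound replaces the length of the curve (\<open>adapted_net\<close>,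
  \<open>overlap_scale_sum_le\<close>). The radii near \<open>Q\<close> are so small compared with \<open>Q\<close> that two points of \<open>X\<close>
  at distance comparable to the side of \<open>Q\<close> are represented by different points of \<open>S\<close>.
\<close>

section \<open>Level sets of continuous functions on a connected set\<close>

lemma connected_no_proper_clopen:
  assumes "connected K" and "closedin (top_of_set K) S" and "openin (top_of_set K) S"
    and "a \<in> S" and "c \<in> K - S"
  shows False
  using assms unfolding connected_clopen by blast

text \<open>
  Think of the level sets \<open>f = t\<close> and \<open>g = s\<close> in \<open>K\<close> as gates that bound the regions \<open>f > t\<close>
  and \<open>g > s\<close>. The first gate lies in the second region, and the second gate is not cut by the
  first region. If it lies outside, then removing the second region from the first one
  leaves a set without boundary; if it lies inside, then the union of both regions has no boundary.
  The points \<open>a\<close> and \<open>c\<close> show that this clopen set is neither empty nor all of \<open>K\<close>.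
\<close>
lemma two_gates_impossible:
  fixes f g :: "'a::topological_space \<Rightarrow> real"
  assumes K: "connected K" and f: "continuous_on K f" and g: "continuous_on K g"
    and a: "a \<in> K" "t < f a" "g a < s"
    and c: "c \<in> K" "f c < t" "g c < s"
    and gate: "\<And>x. x \<in> K \<Longrightarrow> f x = t \<Longrightarrow> s < g x"
    and clean: "(\<forall>x\<in>K. g x = s \<longrightarrow> f x \<le> t) \<or> (\<forall>x\<in>K. g x = s \<longrightarrow> t < f x)"
  shows False
proof -
  have op: "openin (top_of_set K) (K \<inter> f -` {t<..})" "openin (top_of_set K) (K \<inter> g -` {s<..})"
    "openin (top_of_set K) (K \<inter> g -` {..<s})"
    using f g by (auto intro!: continuous_openin_preimage_gen)
  have cl: "closedin (top_of_set K) (K \<inter> f -` {t..})" "closedin (top_of_set K) (K \<inter> g -` {s..})"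
    "closedin (top_of_set K) (K \<inter> g -` {..s})"
    using f g by (auto intro!: continuous_closedin_preimage)
  from clean show False
  proof
    assume cl1: "\<forall>x\<in>K. g x = s \<longrightarrow> f x \<le> t"
    let ?S = "(K \<inter> f -` {t<..}) \<inter> (K \<inter> g -` {..<s})"
    have eq: "?S = (K \<inter> f -` {t..}) \<inter> (K \<inter> g -` {..s})"
    proof -
      have "t < f x \<and> g x < s" if "x \<in> K" "t \<le> f x" "g x \<le> s" for x
        using gate[of x] cl1 that by force
      then show ?thesis by auto
    qed
    have "openin (top_of_set K) ?S" using op by blast
    moreover have "closedin (top_of_set K) ?S" unfolding eq using cl by blast
    ultimately show False
      using connected_no_proper_clopen[OF K, of ?S a c] a c by auto
  next
    assume cl2: "\<forall>x\<in>K. g x = s \<longrightarrow> t < f x"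
    let ?S = "(K \<inter> f -` {t<..}) \<union> (K \<inter> g -` {s<..})"
    have eq: "?S = (K \<inter> f -` {t..}) \<union> (K \<inter> g -` {s..})"
      using gate cl2 by (auto simp: le_less)
    have "openin (top_of_set K) ?S" using op by blast
    moreover have "closedin (top_of_set K) ?S" unfolding eq using cl by blast
    ultimately show False
      using connected_no_proper_clopen[OF K, of ?S a c] a c by auto
  qed
qed

text \<open>
  A gate \<open>g = s\<close> on which \<open>f\<close> varies by less than \<open>\<omega>\<close> cannot be cut by two levels of \<open>f\<close> that
  are \<open>\<omega>\<close> apart. This is how the last hypothesis of the previous lemma is arranged.
\<close>
lemma gate_inside_or_outside:
  fixes f g :: "'a \<Rightarrow> real"
  assumes sg: "\<And>p q. p \<in> K \<Longrightarrow> q \<in> K \<Longrightarrow> g p = s \<Longrightarrow> g q = s \<Longrightarrow> \<bar>f p - f q\<bar> < \<omega>"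
    and "t + \<omega> \<le> t'"
  shows "(\<forall>x\<in>K. g x = s \<longrightarrow> f x \<le> t') \<or> (\<forall>x\<in>K. g x = s \<longrightarrow> t < f x)"
proof (rule ccontr)
  assume "\<not> ?thesis"
  then obtain x y where "x \<in> K" "g x = s" "f x > t'" "y \<in> K" "g y = s" "f y \<le> t"
    by force
  with sg[of x y] assms(2) show False by linarith
qed

text \<open>
  The two points on the level set are told apart by a member of \<open>\<F>\<close> rather than by a distance,
  so that the argument about connectedness needs no metric.
\<close>

definition split_level :: "real \<Rightarrow> ('a \<Rightarrow> real) set \<Rightarrow> 'a set \<Rightarrow> ('a \<Rightarrow> real) \<Rightarrow> real \<Rightarrow> bool" where
  "split_level \<omega> \<F> K F t \<longleftrightarrow>
     (\<exists>p\<in>K. \<exists>q\<in>K. F p = t \<and> F q = t \<and> (\<exists>H\<in>\<F>. \<omega> \<le> \<bar>H p - H q\<bar>))"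

text \<open>
  The functions \<open>f, g, h\<close> behave like barycentric coordinates of a triangle with vertices
  \<open>a, b, c\<close> in \<open>K\<close>, up to an error. If \<open>K\<close> were a tree with level sets that are single points,
  then each region \<open>f > t\<close>, \<open>g > s\<close>, \<open>h > r\<close> with small \<open>t, s, r\<close> would be a branch that contains
  only one of the vertices, although the three regions cover \<open>K\<close>. No point could serve as the centre
  of the tripod, and this is the contradiction. In general the level sets are only known to be small,
  so one of three possible levels of \<open>f\<close> is selected that cuts neither of the gates \<open>g = s\<close> and
  \<open>h = r\<close>; as the coordinates add up to about one, the gate \<open>f = t\<close> lies in one of the regions of
  \<open>g\<close> and \<open>h\<close>.
\<close>
lemma barycentric_split_levels:
  fixes f g h :: "'a::topological_space \<Rightarrow> real"
  defines "\<F> \<equiv> {f, g, h}"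
  assumes K: "connected K"
    and cont: "continuous_on K f" "continuous_on K g" "continuous_on K h"
    and sum: "\<And>x. x \<in> K \<Longrightarrow> 9/10 \<le> f x + g x + h x"
    and a: "a \<in> K" "f a > 1/5" "g a < 1/10" "h a < 1/10"
    and b: "b \<in> K" "f b < 1/10" "h b < 1/10"
    and c: "c \<in> K" "f c < 1/10" "g c < 1/10"
  shows "\<exists>F\<in>\<F>. \<exists>u. \<forall>t\<in>{u..u+1/50}. split_level (1/50) \<F> K F t"
proof (rule ccontr)
  assume contra: "\<not> ?thesis"
  let ?good = "\<lambda>F t. \<not> split_level (1/50) \<F> K F t"
  have ex: "\<exists>t\<in>{u..u+1/50}. ?good F t" if "F \<in> \<F>" for F u
    using contra that by blast
  \<comment> \<open>All levels lie between \<open>1/10\<close> and \<open>1/5\<close>; those of \<open>f\<close> come from three intervals at mutual distance \<open>1/50\<close>.\<close>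
  obtain s where s: "s \<in> {3/25..3/25+1/50}" "?good g s"
    using ex[of g "3/25"] by (auto simp: \<F>_def)
  obtain r where r: "r \<in> {3/25..3/25+1/50}" "?good h r"
    using ex[of h "3/25"] by (auto simp: \<F>_def)
  obtain t1 where t1: "t1 \<in> {1/10..1/10+1/50}" "?good f t1"
    using ex[of f "1/10"] by (auto simp: \<F>_def)
  obtain t2 where t2: "t2 \<in> {7/50..7/50+1/50}" "?good f t2"
    using ex[of f "7/50"] by (auto simp: \<F>_def)
  obtain t3 where t3: "t3 \<in> {9/50..9/50+1/50}" "?good f t3"
    using ex[of f "9/50"] by (auto simp: \<F>_def)
  have small: "\<bar>H p - H q\<bar> < 1/50"
    if "?good F t" "H \<in> \<F>" "p \<in> K" "q \<in> K" "F p = t" "F q = t" for F t H p q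
  proof (rule ccontr)
    assume "\<not> ?thesis"
    then have "\<exists>H\<in>\<F>. 1/50 \<le> \<bar>H p - H q\<bar>" using that(2) by force
    with that(3-6) have "split_level (1/50) \<F> K F t" unfolding split_level_def by blast
    with that(1) show False ..
  qed
  let ?cl = "\<lambda>G s t. (\<forall>x\<in>K. G x = s \<longrightarrow> f x \<le> t) \<or> (\<forall>x\<in>K. G x = s \<longrightarrow> t < f x)"
  let ?in = "\<lambda>G s t. \<forall>x\<in>K. G x = s \<longrightarrow> t < f x"
  let ?out = "\<lambda>G s t. \<forall>x\<in>K. G x = s \<longrightarrow> f x \<le> t"
  \<comment> \<open>The gate \<open>G = v\<close> straddles at most one of the three levels of \<open>f\<close>, since \<open>f\<close> varies on it by less than \<open>1/50\<close>.\<close>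
  have two: "(?cl G v t1 \<and> ?cl G v t2) \<or> (?cl G v t2 \<and> ?cl G v t3) \<or> (?cl G v t1 \<and> ?cl G v t3)"
    if "?good G v" for G v
  proof -
    have gs: "\<bar>f p - f q\<bar> < 1/50" if "p \<in> K" "q \<in> K" "G p = v" "G q = v" for p q
      using small[OF \<open>?good G v\<close>, of f p q] that by (auto simp: \<F>_def)
    have 1: "?out G v t2 \<or> ?in G v t1"
      by (rule gate_inside_or_outside[OF gs]) (use t1 t2 in auto)
    have 2: "?out G v t3 \<or> ?in G v t2"
      by (rule gate_inside_or_outside[OF gs]) (use t2 t3 in auto)
    have 3: "?out G v t2 \<Longrightarrow> ?out G v t3"
      using t2 t3 by force
    from 1 show ?thesis
    proof
      assume "?out G v t2"
      with 3 show ?thesis by simp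
    next
      assume "?in G v t1"
      with 2 show ?thesis by auto
    qed
  qed
  have "\<exists>t. t \<in> {1/10..1/5} \<and> ?good f t \<and> ?cl g s t \<and> ?cl h r t"
  proof -
    define cg ch where "cg t = ?cl g s t" and "ch t = ?cl h r t" for t
    have "(cg t1 \<and> cg t2) \<or> (cg t2 \<and> cg t3) \<or> (cg t1 \<and> cg t3)"
      "(ch t1 \<and> ch t2) \<or> (ch t2 \<and> ch t3) \<or> (ch t1 \<and> ch t3)"
      unfolding cg_def ch_def using two[OF s(2)] two[OF r(2)] by blast+
    then have "\<exists>t\<in>{t1,t2,t3}. cg t \<and> ch t" by blast
    moreover have "\<forall>t\<in>{t1,t2,t3}. t \<in> {1/10..1/5} \<and> ?good f t"
      using t1 t2 t3 by auto
    ultimately show ?thesis unfolding cg_def ch_def by blast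
  qed
  then obtain t where t: "t \<in> {1/10..1/5}" "?good f t" "?cl g s t" "?cl h r t" by blast
  have "(\<forall>x\<in>K. f x = t \<longrightarrow> s < g x) \<or> (\<forall>x\<in>K. f x = t \<longrightarrow> r < h x)"
  proof (rule ccontr)
    assume "\<not> ?thesis"
    then obtain x y where xy: "x \<in> K" "f x = t" "g x \<le> s" "y \<in> K" "f y = t" "h y \<le> r"
      by force
    have "\<bar>g x - g y\<bar> < 1/50" using small[OF t(2), of g x y] xy by (auto simp: \<F>_def)
    with xy sum[of y] t s r show False by auto
  qed
  then show False
  proof
    assume *: "\<forall>x\<in>K. f x = t \<longrightarrow> s < g x"
    show False
      by (rule two_gates_impossible[OF K cont(1,2), of a t s c]) (use a c t s * in auto)
  next
    assume *: "\<forall>x\<in>K. f x = t \<longrightarrow> r < h x"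
    show False
      by (rule two_gates_impossible[OF K cont(1,3), of a t r b]) (use a b t r * in auto)
  qed
qed

text \<open>
  Boundary bumping: the component of \<open>z\<close> in \<open>X \<inter> cball z \<rho>\<close> reaches the sphere. This localises the
  connectedness of \<open>X\<close> to a ball.
\<close>
lemma continuum_to_sphere:
  fixes X :: "'a::euclidean_space set"
  assumes "closed X" "connected X" "z \<in> X" "w \<in> X" "\<rho> < dist z w" "0 \<le> \<rho>"
  obtains K y where "connected K" "K \<subseteq> X \<inter> cball z \<rho>" "z \<in> K" "y \<in> K" "dist z y = \<rho>"
proof -
  let ?T = "top_of_set X" and ?S = "X \<inter> cball z \<rho>"
  let ?C = "connected_component_of_set (subtopology ?T ?S) z"
  have T: "subtopology ?T ?S = top_of_set ?S" by (simp add: subtopology_subtopology Int_absorb1)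
  have zS: "z \<in> ?S" using assms by auto
  have C: "?C \<in> connected_components_of (subtopology ?T ?S)"
    using zS by (auto simp: T connected_components_of_def)
  have compS: "compact ?S" using assms(1) by (simp add: closed_Int_compact)
  have "?C \<inter> ?T frontier_of ?S \<noteq> {}"
  proof (rule boundary_bumping_theorem_closed_gen[OF _ _ _ _ _ _ C])
    show "connected_space ?T" using assms by (simp add: connected_space_subtopology)
    show "locally_compact_space ?T" using assms(1)
      by (simp add: locally_compact_space_closed_subset locally_compact_space_euclidean)
    show "Hausdorff_space ?T" by (simp add: Hausdorff_space_subtopology)
    show "closedin ?T ?S" using assms(1) by (auto simp: closedin_closed_Int)
    have "w \<in> X - ?S" using assms by auto
    then show "?S \<noteq> topspace ?T" by auto
    have "closedin (top_of_set ?S) ?C" using C T closedin_connected_components_of by metis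
    then have "compact ?C" using compS by (metis closedin_compact)
    moreover have "?C \<subseteq> ?S"
      using connected_component_of_subset_topspace[of "subtopology ?T ?S" z] T by auto
    ultimately show "compactin ?T ?C" by (auto simp: compactin_subtopology)
  qed
  then obtain y where y: "y \<in> ?C" "y \<in> ?T frontier_of ?S" by auto
  have CS: "?C \<subseteq> ?S" using connected_component_of_subset_topspace[of "subtopology ?T ?S" z] T by auto
  have "openin ?T (X \<inter> ball z \<rho>)" by (auto intro: openin_open_Int)
  then have "X \<inter> ball z \<rho> \<subseteq> ?T interior_of ?S" by (intro interior_of_maximal) auto
  then have "y \<notin> ball z \<rho>" using y CS by (auto simp: frontier_of_def)
  then have "dist z y = \<rho>" using y CS by auto
  moreover have "connected ?C"
    using connectedin_connected_component_of[of "subtopology ?T ?S" z] T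
    by (auto simp: connectedin_subtopology)
  moreover have "z \<in> ?C" using zS by (simp add: T connected_component_of_refl)
  ultimately show thesis using that[of ?C y] CS y by auto
qed

section \<open>Two points of a non-flat connected set on the same hyperplane\<close>

definition overlapping_level :: "real \<Rightarrow> 'a::real_inner set \<Rightarrow> 'a \<Rightarrow> real \<Rightarrow> bool" where
  "overlapping_level \<delta> K e t \<longleftrightarrow> (\<exists>p\<in>K. \<exists>q\<in>K. e \<bullet> p = t \<and> e \<bullet> q = t \<and> \<delta> \<le> dist p q)"

lemma overlapping_level_mono:
  "overlapping_level \<delta> K e t \<Longrightarrow> K \<subseteq> K' \<Longrightarrow> \<delta>' \<le> \<delta> \<Longrightarrow> overlapping_level \<delta>' K' e t"
  unfolding overlapping_level_def by (meson order_trans subsetD)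

lemma inner_close:
  fixes e v x :: "'a::real_inner"
  assumes "norm (e - v) \<le> \<kappa>" "norm x \<le> A" "0 \<le> \<kappa>"
  shows "\<bar>e \<bullet> x - v \<bullet> x\<bar> \<le> \<kappa> * A"
proof -
  have "\<bar>(e - v) \<bullet> x\<bar> \<le> norm (e - v) * norm x" by (rule Cauchy_Schwarz_ineq2)
  also have "\<dots> \<le> \<kappa> * A" using assms by (intro mult_mono) auto
  finally show ?thesis by (simp add: inner_diff_left)
qed

text \<open>
  The points \<open>0, b, c\<close> form a triangle that is not too thin, so its barycentric coordinates are
  affine functions with controlled gradients. The gradients are replaced by elements of the net
  \<open>D\<close>, which changes the coordinates by at most \<open>1/40\<close> on \<open>K\<close>. A difference of \<open>1/50\<close> in a coordinate
  forces a distance, since the coordinates are Lipschitz with constant \<open>R + 1\<close>.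
\<close>
lemma bent_continuum_overlaps:
  fixes K D :: "'a::euclidean_space set"
  assumes K: "connected K" "K \<subseteq> cball 0 A" "0 \<in> K" "b \<in> K" "norm b = A" "c \<in> K"
    and \<epsilon>: "0 < \<epsilon>" "\<epsilon> \<le> infdist c (span {b})" and A: "0 < A"
    and R: "1 / A + 2 / \<epsilon> \<le> R" and \<kappa>: "0 \<le> \<kappa>" "\<kappa> \<le> 1" "\<kappa> * A \<le> 1/40"
    and net: "\<And>v. norm v \<le> R \<Longrightarrow> \<exists>e\<in>D. norm (e - v) \<le> \<kappa>"
  shows "\<exists>e\<in>D. \<exists>u. \<forall>t\<in>{u..u+1/50}. overlapping_level (1 / (50 * (R + 1))) K e t"
proof -
  define v where "v = c - ((c \<bullet> b) / (b \<bullet> b)) *\<^sub>R b"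
  have bb: "b \<bullet> b = A\<^sup>2" "b \<bullet> b > 0" "b \<noteq> 0" using K(5) A by (auto simp: power2_norm_eq_inner[symmetric])
  have "((c \<bullet> b) / (b \<bullet> b)) *\<^sub>R b \<in> span {b}" by (simp add: span_mul span_base)
  then have "infdist c (span {b}) \<le> norm v"
    using infdist_le[of _ "span {b}" c] by (simp add: v_def dist_norm)
  then have v\<epsilon>: "\<epsilon> \<le> norm v" using \<epsilon> by simp
  then have v0: "v \<noteq> 0" "v \<bullet> v > 0" using \<epsilon> by auto
  have vb: "v \<bullet> b = 0" using bb by (simp add: v_def inner_diff_left)
  have vc: "v \<bullet> c = v \<bullet> v"
  proof -
    have "v \<bullet> v = v \<bullet> c - ((c \<bullet> b) / (b \<bullet> b)) * (v \<bullet> b)"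
      by (subst (2) v_def) (simp add: inner_diff_right)
    then show ?thesis using vb by simp
  qed
  \<comment> \<open>Gradients of the barycentric coordinates that belong to \<open>c\<close>, \<open>b\<close> and \<open>0\<close>.\<close>
  define ec where "ec = (1 / (v \<bullet> v)) *\<^sub>R v"
  define eb where "eb = (1 / (b \<bullet> b)) *\<^sub>R b - ((b \<bullet> c) / (b \<bullet> b)) *\<^sub>R ec"
  have ec: "ec \<bullet> b = 0" "ec \<bullet> c = 1" using v0 vb vc by (auto simp: ec_def)
  have eb: "eb \<bullet> b = 1" "eb \<bullet> c = 0"
    using ec bb by (auto simp: eb_def inner_diff_left)
  have nec: "norm ec \<le> 1 / \<epsilon>"
  proof -
    have "norm ec = 1 / norm v" using v0
      by (simp add: ec_def power2_norm_eq_inner[symmetric] power2_eq_square)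
    also have "\<dots> \<le> 1 / \<epsilon>" using v\<epsilon> \<epsilon> by (simp add: frac_le)
    finally show ?thesis .
  qed
  have cA: "norm c \<le> A" using K by auto
  have neb: "norm eb \<le> 1 / A + 1 / \<epsilon>"
  proof -
    have "norm ((1 / (b \<bullet> b)) *\<^sub>R b) = 1 / A"
      using K(5) A by (simp add: power2_norm_eq_inner[symmetric] power2_eq_square)
    moreover have "norm (((b \<bullet> c) / (b \<bullet> b)) *\<^sub>R ec) \<le> 1 * (1/\<epsilon>)"
    proof -
      have "\<bar>b \<bullet> c\<bar> \<le> norm b * norm c" by (rule Cauchy_Schwarz_ineq2)
      also have "\<dots> \<le> A * A" using K(5) cA A by (intro mult_mono) auto
      finally have "\<bar>(b \<bullet> c) / (b \<bullet> b)\<bar> \<le> 1" using bb A by (simp add: power2_eq_square)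
      then show ?thesis using nec \<epsilon> by (simp only: norm_scaleR) (intro mult_mono; simp)
    qed
    ultimately show ?thesis
      using norm_triangle_ineq4[of "(1 / (b \<bullet> b)) *\<^sub>R b" "((b \<bullet> c) / (b \<bullet> b)) *\<^sub>R ec"]
      unfolding eb_def by linarith
  qed
  define ea where "ea = - (eb + ec)"
  have nea: "norm ea \<le> 1 / A + 2 / \<epsilon>"
    using norm_triangle_ineq[of eb ec] neb nec unfolding ea_def norm_minus_cancel by simp
  have pos: "0 < 1/A" "0 < 1/\<epsilon>" "2/\<epsilon> = 1/\<epsilon> + 1/\<epsilon>" using A \<epsilon> by auto
  have "norm ea \<le> R" "norm eb \<le> R" "norm ec \<le> R" using nea neb nec R pos by linarith+
  then obtain da db dc where da: "da \<in> D" "norm (da - ea) \<le> \<kappa>"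
    and db: "db \<in> D" "norm (db - eb) \<le> \<kappa>" and dc: "dc \<in> D" "norm (dc - ec) \<le> \<kappa>"
    using net by meson
  have nd: "norm da \<le> R + 1" "norm db \<le> R + 1" "norm dc \<le> R + 1"
  proof -
    show "norm da \<le> R + 1"
      using norm_triangle_sub[of da ea] da(2) nea R \<kappa> by linarith
    show "norm db \<le> R + 1"
      using norm_triangle_sub[of db eb] db(2) neb R pos \<kappa> by linarith
    show "norm dc \<le> R + 1"
      using norm_triangle_sub[of dc ec] dc(2) nec R pos \<kappa> by linarith
  qed
  have cl: "\<bar>d \<bullet> x - e \<bullet> x\<bar> \<le> 1/40" if "norm (d - e) \<le> \<kappa>" "x \<in> K" for d e x
    using inner_close[OF that(1), of x A] that(2) K(2) \<kappa> by force
  define f g h where "f x = 1 + da \<bullet> x" and "g x = db \<bullet> x" and "h x = dc \<bullet> x" for x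
  have "\<exists>F\<in>{f,g,h}. \<exists>u. \<forall>t\<in>{u..u+1/50}. split_level (1/50) {f,g,h} K F t"
  proof (rule barycentric_split_levels[of K f g h 0 b c])
    show "continuous_on K f" "continuous_on K g" "continuous_on K h"
      unfolding f_def g_def h_def by (intro continuous_intros)+
    fix x assume "x \<in> K"
    have "ea \<bullet> x + eb \<bullet> x + ec \<bullet> x = 0" by (simp add: ea_def inner_add_left inner_diff_left)
    then show "9/10 \<le> f x + g x + h x"
      using cl[OF da(2) \<open>x \<in> K\<close>] cl[OF db(2) \<open>x \<in> K\<close>] cl[OF dc(2) \<open>x \<in> K\<close>]
      unfolding f_def g_def h_def by linarith
  next
    have "ea \<bullet> b = -1" "ea \<bullet> c = -1" using eb ec by (auto simp: ea_def inner_add_left inner_diff_left)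
    then show "f b < 1/10" "h b < 1/10" "f c < 1/10" "g c < 1/10"
      using cl[OF da(2) K(4)] cl[OF dc(2) K(4)] cl[OF da(2) K(6)] cl[OF db(2) K(6)] eb ec
      unfolding f_def g_def h_def by linarith+
  qed (use K in \<open>auto simp: f_def g_def h_def\<close>)
  then obtain F u where F: "F \<in> {f,g,h}" "\<And>t. t \<in> {u..u+1/50} \<Longrightarrow> split_level (1/50) {f,g,h} K F t"
    by blast
  have lip: "\<bar>H p - H q\<bar> \<le> (R + 1) * dist p q" if "H \<in> {f,g,h}" for H p q
  proof -
    have "\<bar>d \<bullet> p - d \<bullet> q\<bar> \<le> (R + 1) * dist p q" if "norm d \<le> R + 1" for d
    proof -
      have "\<bar>d \<bullet> (p - q)\<bar> \<le> norm d * norm (p - q)" by (rule Cauchy_Schwarz_ineq2)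
      also have "\<dots> \<le> (R + 1) * norm (p - q)" using that by (intro mult_right_mono) auto
      finally show ?thesis by (simp add: inner_diff_right dist_norm)
    qed
    then show ?thesis using that nd by (auto simp: f_def g_def h_def)
  qed
  have R1: "R + 1 > 0" using R pos by linarith
  obtain e s where es: "e \<in> D" "\<And>x. F x = e \<bullet> x + s"
  proof -
    consider "F = f" | "F = g" | "F = h" using F(1) by auto
    then show thesis
      by cases (use that[of da 1] that[of db 0] that[of dc 0] da db dc in \<open>auto simp: f_def g_def h_def\<close>)
  qed
  show ?thesis
  proof (intro bexI[OF _ es(1)] exI[of _ "u - s"] ballI)
    fix t assume "t \<in> {u - s..u - s + 1/50}"
    then have "t + s \<in> {u..u+1/50}" by auto
    from F(2)[OF this] obtain p q H where pq: "p \<in> K" "q \<in> K" "F p = t + s" "F q = t + s"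
      "H \<in> {f,g,h}" "1/50 \<le> \<bar>H p - H q\<bar>"
      unfolding split_level_def by blast
    have "1/50 \<le> (R + 1) * dist p q" using lip[OF pq(5), of p q] pq(6) by linarith
    then have "1 / (50 * (R + 1)) \<le> dist p q" using R1 by (simp add: field_simps)
    then show "overlapping_level (1 / (50 * (R + 1))) K e t"
      unfolding overlapping_level_def using pq es(2) by force
  qed
qed

text \<open>
  The continuum \<open>K\<close> follows a long straight segment from \<open>0\<close> to \<open>b\<close>, and the small continuum \<open>C\<close> stays
  off that line. The direction \<open>e0\<close> is the direction of the segment, tilted so strongly towards \<open>p\<close> that
  the projection of \<open>C\<close> falls between those of \<open>0\<close> and \<open>b\<close>; the length \<open>4 + 4/\<epsilon>\<close> of the segment
  leaves room for this. Every level between the projections of \<open>p\<close> and \<open>q\<close> then meets both sets,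
  and they keep a distance of at least \<open>\<epsilon>/2\<close>.
\<close>
lemma straight_continuum_with_outlier_overlaps:
  fixes K C D :: "'a::euclidean_space set"
  assumes K: "connected K" "0 \<in> K" "b \<in> K" "norm b = 4 + 4 / \<epsilon>"
    and flat: "\<And>x. x \<in> K \<Longrightarrow> infdist x (span {b}) \<le> \<epsilon> / 4"
    and \<epsilon>: "0 < \<epsilon>" "\<epsilon> \<le> 1"
    and p: "norm p < 1" "\<epsilon> \<le> infdist p (span {b})"
    and C: "connected C" "p \<in> C" "q \<in> C" "C \<subseteq> cball p (\<epsilon> / 4)" "dist p q = \<epsilon> / 4"
    and R: "10 / \<epsilon> \<le> R" and \<eta>: "\<eta> = 1 / (8 * (4 + 4 / \<epsilon>))" and \<kappa>: "0 \<le> \<kappa>" "\<kappa> \<le> \<eta> / 4"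
    and net: "\<And>v. norm v \<le> R \<Longrightarrow> \<exists>e\<in>D. norm (e - v) \<le> \<kappa>"
  shows "\<exists>e\<in>D. \<exists>u. \<forall>t\<in>{u..u+\<eta>*\<epsilon>/16}. overlapping_level (\<epsilon> / 2) (K \<union> C) e t"
proof -
  define \<tau> where "\<tau> = 4 / \<epsilon>"
  define A where "A = 4 + \<tau>"
  have \<tau>: "\<tau> \<ge> 4" "\<tau> * \<epsilon> = 4" using \<epsilon> by (auto simp: \<tau>_def field_simps)
  have A: "norm b = A" "A \<ge> 8" "\<eta> = 1 / (8 * A)" using K \<eta> \<tau> by (auto simp: A_def \<tau>_def)
  have \<eta>0: "\<eta> > 0" "\<eta> \<le> 1/64" "\<eta> * A = 1/8"
    using A(2) unfolding A(3) by (simp_all add: field_simps)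
  define w where "w = (1 / A) *\<^sub>R b"
  have w: "norm w = 1" using A by (simp add: w_def)
  then have ww: "w \<bullet> w = 1" by (simp add: norm_eq_1)
  have wb: "b = A *\<^sub>R w" using A by (simp add: w_def)
  define x where "x = p \<bullet> w"
  have x: "\<bar>x\<bar> \<le> 1" using Cauchy_Schwarz_ineq2[of p w] w p by (simp add: x_def)
  define v where "v = p - x *\<^sub>R w"
  define y where "y = norm v"
  have "x *\<^sub>R w \<in> span {b}" by (simp add: w_def span_mul span_base)
  then have y\<epsilon>: "\<epsilon> \<le> y"
    using infdist_le[of "x *\<^sub>R w" "span {b}" p] p(2) by (simp add: y_def v_def dist_norm)
  have vw: "v \<bullet> w = 0" "w \<bullet> v = 0"
    using ww by (auto simp: v_def inner_diff_left inner_diff_right x_def inner_commute)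
  have vv: "v \<bullet> v = y\<^sup>2" by (simp add: y_def power2_norm_eq_inner)
  have vp: "v \<bullet> p = y\<^sup>2"
  proof -
    have "v \<bullet> v = v \<bullet> p - x * (v \<bullet> w)" by (subst (2) v_def) (simp add: inner_diff_right)
    then show ?thesis using vw vv by simp
  qed
  have y1: "y \<le> 1"
  proof -
    have "y\<^sup>2 = v \<bullet> p" using vp by simp
    also have "\<dots> \<le> norm v * norm p" by (rule norm_cauchy_schwarz)
    also have "\<dots> \<le> y * 1" using p by (intro mult_mono) (auto simp: y_def)
    finally show ?thesis using y\<epsilon> \<epsilon> by (simp add: power2_eq_square)
  qed
  define e0 where "e0 = w + (\<tau> / y) *\<^sub>R v"
  have e0p: "e0 \<bullet> p = x + \<tau> * y"
  proof -
    have "e0 \<bullet> p = w \<bullet> p + (\<tau> / y) * (v \<bullet> p)" by (simp add: e0_def inner_add_left)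
    also have "w \<bullet> p = x" by (simp add: x_def inner_commute)
    also have "(\<tau> / y) * (v \<bullet> p) = \<tau> * y" using y\<epsilon> \<epsilon> vp by (simp add: power2_eq_square)
    finally show ?thesis .
  qed
  have e0b: "e0 \<bullet> b = A" using vw ww by (simp add: e0_def wb inner_add_left inner_scaleR_right)
  have ne0: "norm e0 \<le> 1 + \<tau>"
    using norm_triangle_ineq[of w "(\<tau> / y) *\<^sub>R v"] w \<tau> y\<epsilon> \<epsilon> by (auto simp: e0_def y_def[symmetric])
  have ty: "4 \<le> \<tau> * y" "\<tau> * y \<le> \<tau>"
  proof -
    have "\<tau> * \<epsilon> \<le> \<tau> * y" using \<tau> y\<epsilon> by (intro mult_left_mono) auto
    then show "4 \<le> \<tau> * y" using \<tau> by simp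
    show "\<tau> * y \<le> \<tau>" using mult_left_mono[OF y1, of \<tau>] \<tau> by simp
  qed
  have e0p': "3 \<le> e0 \<bullet> p" "e0 \<bullet> p \<le> 1 + \<tau>" using e0p x ty by (auto simp: abs_le_iff)
  have nqp: "norm (q - p) = \<epsilon> / 4" using C(5) by (simp add: dist_norm norm_minus_commute)
  have "\<bar>e0 \<bullet> (q - p)\<bar> \<le> norm e0 * norm (q - p)" by (rule Cauchy_Schwarz_ineq2)
  also have "\<dots> \<le> (1 + \<tau>) * (\<epsilon> / 4)" unfolding nqp using ne0 \<epsilon> by (intro mult_right_mono) auto
  also have "\<dots> = \<epsilon> / 4 + 1" using \<tau> by (simp add: algebra_simps)
  finally have "\<bar>e0 \<bullet> (q - p)\<bar> \<le> 5/4" using \<epsilon> by linarith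
  then have e0q: "7/4 \<le> e0 \<bullet> q" "e0 \<bullet> q \<le> 9/4 + \<tau>"
    using e0p' unfolding inner_diff_right by linarith+
  \<comment> \<open>Perturb the direction so that it is transversal to the segment from \<open>p\<close> to \<open>q\<close>.\<close>
  define n where "n = (4 / \<epsilon>) *\<^sub>R (q - p)"
  have n: "norm n = 1" using nqp \<epsilon> by (simp add: n_def)
  have nn: "n \<bullet> (q - p) = \<epsilon> / 4"
  proof -
    have "n \<bullet> (q - p) = (4 / \<epsilon>) * (norm (q - p))\<^sup>2" by (simp add: n_def power2_norm_eq_inner)
    then show ?thesis using nqp \<epsilon> by (simp add: power2_eq_square)
  qed
  have "\<exists>e1. norm (e1 - e0) \<le> \<eta> \<and> \<eta> * \<epsilon> / 8 \<le> \<bar>e1 \<bullet> (q - p)\<bar>"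
  proof (cases "\<eta> * \<epsilon> / 8 \<le> \<bar>e0 \<bullet> (q - p)\<bar>")
    case True
    then show ?thesis using \<eta>0 by (intro exI[of _ e0]) auto
  next
    case False
    have "(e0 + \<eta> *\<^sub>R n) \<bullet> (q - p) = e0 \<bullet> (q - p) + \<eta> * \<epsilon> / 4"
      using nn by (simp add: inner_add_left)
    then have "\<eta> * \<epsilon> / 8 \<le> \<bar>(e0 + \<eta> *\<^sub>R n) \<bullet> (q - p)\<bar>" using False by linarith
    then show ?thesis using n \<eta>0 by (intro exI[of _ "e0 + \<eta> *\<^sub>R n"]) auto
  qed
  then obtain e1 where e1: "norm (e1 - e0) \<le> \<eta>" "\<eta> * \<epsilon> / 8 \<le> \<bar>e1 \<bullet> (q - p)\<bar>" by blast
  have "norm e1 \<le> R"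
  proof -
    have "norm e1 \<le> 2 + \<tau>" using norm_triangle_sub[of e1 e0] e1(1) ne0 \<eta>0 by linarith
    also have "\<dots> \<le> 10 / \<epsilon>" using \<epsilon> by (simp add: \<tau>_def field_simps)
    finally show ?thesis using R by linarith
  qed
  from net[OF this] obtain e where e: "e \<in> D" "norm (e - e1) \<le> \<kappa>" by blast
  have ee0: "norm (e - e0) \<le> 2 * \<eta>"
    using norm_triangle_ineq[of "e - e1" "e1 - e0"] e(2) e1(1) \<kappa> \<eta>0 by simp
  have trans: "\<eta> * \<epsilon> / 16 \<le> \<bar>e \<bullet> q - e \<bullet> p\<bar>"
  proof -
    have "\<bar>e \<bullet> (q - p) - e1 \<bullet> (q - p)\<bar> \<le> (\<eta> / 4) * (\<epsilon> / 4)"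
      by (rule inner_close) (use e(2) \<kappa> nqp \<eta>0 in auto)
    then show ?thesis using e1(2) by (simp add: inner_diff_right abs_le_iff abs_if split: if_splits)
  qed
  have nq: "norm q \<le> 2" using norm_triangle_sub[of q p] nqp p \<epsilon> by linarith
  have "\<bar>e \<bullet> p - e0 \<bullet> p\<bar> \<le> 2 * \<eta> * 2" by (rule inner_close[OF ee0]) (use p \<eta>0 in auto)
  moreover have "\<bar>e \<bullet> q - e0 \<bullet> q\<bar> \<le> 2 * \<eta> * 2" by (rule inner_close[OF ee0]) (use nq \<eta>0 in auto)
  moreover have "\<bar>e \<bullet> b - e0 \<bullet> b\<bar> \<le> 2 * \<eta> * A" by (rule inner_close[OF ee0]) (use A \<eta>0 in auto)
  ultimately have range: "0 \<le> min (e \<bullet> p) (e \<bullet> q)" "max (e \<bullet> p) (e \<bullet> q) \<le> e \<bullet> b"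
    using e0p' e0q e0b \<eta>0 A_def by linarith+
  show ?thesis
  proof (intro bexI[OF _ e(1)] exI[of _ "min (e \<bullet> p) (e \<bullet> q)"] ballI)
    fix t assume "t \<in> {min (e \<bullet> p) (e \<bullet> q)..min (e \<bullet> p) (e \<bullet> q) + \<eta> * \<epsilon> / 16}"
    then have t: "min (e \<bullet> p) (e \<bullet> q) \<le> t" "t \<le> max (e \<bullet> p) (e \<bullet> q)"
      using trans by (auto simp: min_def max_def abs_if split: if_splits)
    have "\<exists>z\<in>C. e \<bullet> z = t"
    proof (cases "e \<bullet> p \<le> e \<bullet> q")
      case True
      show ?thesis by (rule connected_ivt_hyperplane[OF C(1,2,3)]) (use True t in auto)
    next
      case False
      show ?thesis by (rule connected_ivt_hyperplane[OF C(1,3,2)]) (use False t in auto)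
    qed
    then obtain p' where p': "p' \<in> C" "e \<bullet> p' = t" by blast
    have "\<exists>z\<in>K. e \<bullet> z = t"
      by (rule connected_ivt_hyperplane[OF K(1,2,3)]) (use t range in auto)
    then obtain q' where q': "q' \<in> K" "e \<bullet> q' = t" by blast
    have "infdist p (span {b}) \<le> infdist p' (span {b}) + dist p p'" by (rule infdist_triangle)
    moreover have "infdist p' (span {b}) \<le> infdist q' (span {b}) + dist p' q'" by (rule infdist_triangle)
    moreover have "dist p p' \<le> \<epsilon> / 4" using p' C(4) by auto
    ultimately have "\<epsilon> / 2 \<le> dist p' q'" using p(2) flat[OF q'(1)] by linarith
    then show "overlapping_level (\<epsilon> / 2) (K \<union> C) e t"
      unfolding overlapping_level_def using p' q' by blast
  qed
qed

lemma finite_direction_net: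
  fixes R \<kappa> :: real
  assumes "0 < \<kappa>"
  obtains D :: "'a::euclidean_space set" where "finite D" "D \<subseteq> cball 0 R"
    "\<And>v. norm v \<le> R \<Longrightarrow> \<exists>e\<in>D. norm (e - v) \<le> \<kappa>"
proof -
  have "compact (cball (0::'a) R)" by simp
  moreover have "cball (0::'a) R \<subseteq> (\<Union>x\<in>cball 0 R. ball x \<kappa>)" using assms by force
  ultimately obtain D where D: "D \<subseteq> cball (0::'a) R" "finite D" "cball 0 R \<subseteq> (\<Union>x\<in>D. ball x \<kappa>)"
    by (elim compactE_image) auto
  have "\<exists>e\<in>D. norm (e - v) \<le> \<kappa>" if "norm v \<le> R" for v
  proof -
    have "v \<in> cball 0 R" using that by simp
    with D(3) obtain e where "e \<in> D" "dist e v < \<kappa>" by auto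
    then show ?thesis by (auto simp: dist_norm intro!: bexI[of _ e])
  qed
  with D that show thesis by blast
qed

text \<open>
  Follow the component of \<open>X\<close> from \<open>0\<close> up to the sphere of radius \<open>A\<close>. Either it leaves the
  neighbourhood of the line through its end point \<open>b\<close>, and then it contains a triangle, or it stays
  close to that line, and then some other point of \<open>X\<close> in the unit ball is far from the line.
\<close>
lemma nonflat_overlaps_unit_scale:
  fixes \<epsilon> :: real
  assumes \<epsilon>: "0 < \<epsilon>" "\<epsilon> \<le> 1"
  obtains D :: "'a::euclidean_space set" and \<Lambda> A \<delta> h :: real where
    "finite D" "\<And>e. e \<in> D \<Longrightarrow> norm e \<le> \<Lambda>" "0 < \<Lambda>" "1 \<le> A" "0 < \<delta>" "0 < h"
    "\<And>X w. closed X \<Longrightarrow> connected X \<Longrightarrow> 0 \<in> X \<Longrightarrow> w \<in> X \<Longrightarrow> A < norm w \<Longrightarrow>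
      (\<And>b. b \<noteq> 0 \<Longrightarrow> \<exists>p\<in>X. norm p < 1 \<and> \<epsilon> \<le> infdist p (span {b})) \<Longrightarrow>
      \<exists>e\<in>D. \<exists>u. \<forall>t\<in>{u..u+h}. overlapping_level \<delta> (X \<inter> cball 0 A) e t"
proof -
  define A where "A = 4 + 4 / \<epsilon>"
  define R where "R = 10 / \<epsilon>"
  define \<eta> where "\<eta> = 1 / (8 * (4 + 4 / \<epsilon>))"
  define \<kappa> where "\<kappa> = \<eta> / 8"
  have A: "A \<ge> 8" using \<epsilon> by (simp add: A_def field_simps)
  have \<eta>A: "\<eta> = 1 / (8 * A)" by (simp add: \<eta>_def A_def)
  have \<kappa>A: "\<kappa> = 1 / (64 * A)" by (simp add: \<kappa>_def \<eta>A)
  have \<eta>: "0 < \<eta>" using A unfolding \<eta>A by simp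
  have \<kappa>: "0 < \<kappa>" "\<kappa> \<le> 1" "\<kappa> * A \<le> 1/40" "\<kappa> \<le> \<eta> / 4"
    using A \<eta> unfolding \<kappa>A by (auto simp: \<eta>A field_simps)
  have R: "0 < R" "1 / A + 2 / (\<epsilon> / 4) \<le> R"
  proof -
    show "0 < R" using \<epsilon> by (simp add: R_def)
    have "1 / A \<le> 1" using A by simp
    also have "1 \<le> 2 / \<epsilon>" using \<epsilon> by simp
    finally have "1 / A + 8 / \<epsilon> \<le> 2 / \<epsilon> + 8 / \<epsilon>" by simp
    also have "\<dots> = R" by (simp add: R_def add_divide_distrib[symmetric])
    finally show "1 / A + 2 / (\<epsilon> / 4) \<le> R" by simp
  qed
  obtain D :: "'a set" where D: "finite D" "D \<subseteq> cball 0 R"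
    and net: "\<And>v. norm v \<le> R \<Longrightarrow> \<exists>e\<in>D. norm (e - v) \<le> \<kappa>"
    using finite_direction_net[OF \<kappa>(1), of R] by metis
  define \<delta> where "\<delta> = min (1 / (50 * (R + 1))) (\<epsilon> / 2)"
  define h where "h = min (1/50) (\<eta> * \<epsilon> / 16)"
  show thesis
  proof (rule that[of D R A \<delta> h])
    show "finite D" "0 < R" "1 \<le> A" "0 < \<delta>" "0 < h" "\<And>e. e \<in> D \<Longrightarrow> norm e \<le> R"
      using D R A \<epsilon> \<eta> by (auto simp: \<delta>_def h_def)
    fix X :: "'a set" and w
    assume X: "closed X" "connected X" "0 \<in> X" "w \<in> X" "A < norm w"
      and far: "\<And>b. b \<noteq> 0 \<Longrightarrow> \<exists>p\<in>X. norm p < 1 \<and> \<epsilon> \<le> infdist p (span {b})"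
    have shrink: "\<exists>e\<in>D. \<exists>u. \<forall>t\<in>{u..u+h}. overlapping_level \<delta> (X \<inter> cball 0 A) e t"
      if "\<exists>e\<in>D. \<exists>u. \<forall>t\<in>{u..u+h'}. overlapping_level \<delta>' Y e t" "Y \<subseteq> X \<inter> cball 0 A" "\<delta> \<le> \<delta>'" "h \<le> h'"
      for \<delta>' Y h'
    proof -
      from that(1) obtain e u where eu: "e \<in> D" "\<forall>t\<in>{u..u+h'}. overlapping_level \<delta>' Y e t" by blast
      have "overlapping_level \<delta> (X \<inter> cball 0 A) e t" if "t \<in> {u..u+h}" for t
        using overlapping_level_mono[OF _ \<open>Y \<subseteq> _\<close> \<open>\<delta> \<le> \<delta>'\<close>] eu(2) that \<open>h \<le> h'\<close> by auto
      with eu(1) show ?thesis by blast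
    qed
    obtain K b where K: "connected K" "K \<subseteq> X \<inter> cball 0 A" "0 \<in> K" "b \<in> K" "norm b = A"
      by (rule continuum_to_sphere[OF X(1,2,3,4), of A]) (use X A in auto)
    have b0: "b \<noteq> 0" using K A by auto
    show "\<exists>e\<in>D. \<exists>u. \<forall>t\<in>{u..u+h}. overlapping_level \<delta> (X \<inter> cball 0 A) e t"
    proof (cases "\<forall>x\<in>K. infdist x (span {b}) \<le> \<epsilon> / 4")
      case False
      then obtain c where c: "c \<in> K" "\<epsilon> / 4 \<le> infdist c (span {b})" by force
      have "\<exists>e\<in>D. \<exists>u. \<forall>t\<in>{u..u+1/50}. overlapping_level (1 / (50 * (R + 1))) K e t"
        by (rule bent_continuum_overlaps[where A=A and b=b and c=c and \<epsilon>="\<epsilon>/4" and \<kappa>=\<kappa>])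
          (use K c \<epsilon> A R \<kappa> net in auto)
      then show ?thesis using K(2) by (rule shrink) (auto simp: \<delta>_def h_def)
    next
      case True
      obtain p where p: "p \<in> X" "norm p < 1" "\<epsilon> \<le> infdist p (span {b})" using far[OF b0] by blast
      have "\<epsilon> / 4 < dist p w"
        using norm_triangle_sub[of w p] p X(5) A \<epsilon> by (simp add: dist_norm norm_minus_commute)
      then obtain C q where C: "connected C" "C \<subseteq> X \<inter> cball p (\<epsilon>/4)" "p \<in> C" "q \<in> C" "dist p q = \<epsilon>/4"
        by (rule continuum_to_sphere[OF X(1,2) p(1) X(4)]) (use \<epsilon> in auto)
      have "\<exists>e\<in>D. \<exists>u. \<forall>t\<in>{u..u+\<eta>*\<epsilon>/16}. overlapping_level (\<epsilon> / 2) (K \<union> C) e t"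
        by (rule straight_continuum_with_outlier_overlaps[where p=p and q=q and b=b and R=R and \<kappa>=\<kappa>])
          (use K C True \<epsilon> p \<kappa> net in \<open>auto simp: A_def R_def \<eta>_def\<close>)
      moreover have "K \<union> C \<subseteq> X \<inter> cball 0 A"
      proof -
        have "norm x \<le> A" if "x \<in> C" for x
        proof -
          have "dist p x \<le> \<epsilon>/4" using that C(2) by auto
          then show ?thesis
            using norm_triangle_sub[of x p] p(2) A \<epsilon> by (simp add: dist_norm norm_minus_commute)
        qed
        then show ?thesis using K(2) C(2) by auto
      qed
      ultimately show ?thesis by (rule shrink) (auto simp: \<delta>_def h_def)
    qed
  qed
qed

lemma nonflat_overlaps:
  fixes \<epsilon> :: real
  assumes \<epsilon>: "0 < \<epsilon>" "\<epsilon> \<le> 1"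
  obtains D :: "'a::euclidean_space set" and \<Lambda> A \<delta> h :: real where
    "finite D" "\<And>e. e \<in> D \<Longrightarrow> norm e \<le> \<Lambda>" "0 < \<Lambda>" "1 \<le> A" "0 < \<delta>" "0 < h"
    "\<And>X z w r. closed X \<Longrightarrow> connected X \<Longrightarrow> z \<in> X \<Longrightarrow> 0 < r \<Longrightarrow> w \<in> X \<Longrightarrow> A * r < dist z w \<Longrightarrow>
      (\<And>L. affine L \<Longrightarrow> aff_dim L = 1 \<Longrightarrow> \<exists>p\<in>X. dist z p < r \<and> \<epsilon> * r \<le> infdist p L) \<Longrightarrow>
      \<exists>e\<in>D. \<exists>u. \<forall>t\<in>{u..u+h*r}. overlapping_level (\<delta>*r) (X \<inter> cball z (A*r)) e t"
proof (rule nonflat_overlaps_unit_scale[OF \<epsilon>, where 'a='a])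
  fix D :: "'a set" and \<Lambda> A \<delta> h :: real
  assume *: "finite D" "\<And>e. e \<in> D \<Longrightarrow> norm e \<le> \<Lambda>" "0 < \<Lambda>" "1 \<le> A" "0 < \<delta>" "0 < h"
    and unit: "\<And>X w. closed X \<Longrightarrow> connected X \<Longrightarrow> 0 \<in> X \<Longrightarrow> w \<in> X \<Longrightarrow> A < norm w \<Longrightarrow>
      (\<And>b. b \<noteq> 0 \<Longrightarrow> \<exists>p\<in>X. norm p < 1 \<and> \<epsilon> \<le> infdist p (span {b})) \<Longrightarrow>
      \<exists>e\<in>D. \<exists>u. \<forall>t\<in>{u..u+h}. overlapping_level \<delta> (X \<inter> cball 0 A) e t"
  show thesis
  proof (rule that[of D \<Lambda> A \<delta> h])
    fix X :: "'a set" and z w r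
    assume X: "closed X" "connected X" "z \<in> X" and r: "0 < r" and w: "w \<in> X" "A * r < dist z w"
      and far: "\<And>L. affine L \<Longrightarrow> aff_dim L = 1 \<Longrightarrow> \<exists>p\<in>X. dist z p < r \<and> \<epsilon> * r \<le> infdist p L"
    define \<phi> where "\<phi> x = (1/r) *\<^sub>R (x - z)" for x
    define \<psi> where "\<psi> y = z + r *\<^sub>R y" for y
    have inv: "\<phi> (\<psi> y) = y" "\<psi> (\<phi> x) = x" for x y using r by (auto simp: \<phi>_def \<psi>_def)
    have d\<psi>: "dist (\<psi> p) (\<psi> q) = r * dist p q" for p q
      using r by (simp add: \<psi>_def dist_norm scaleR_right_diff_distrib[symmetric])
    have \<psi>0: "\<psi> 0 = z" "\<phi> z = 0" by (auto simp: \<psi>_def \<phi>_def)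
    have Y: "\<phi> ` X = \<psi> -` X"
    proof (intro set_eqI iffI)
      fix y assume "y \<in> \<psi> -` X"
      then have "\<phi> (\<psi> y) \<in> \<phi> ` X" by blast
      then show "y \<in> \<phi> ` X" by (simp add: inv)
    qed (auto simp: inv)
    have "closed (\<phi> ` X)"
      unfolding Y \<psi>_def by (rule continuous_closed_vimage[OF X(1)]) (intro continuous_intros)
    moreover have "connected (\<phi> ` X)"
      unfolding \<phi>_def by (intro connected_continuous_image X continuous_intros)
    moreover have "0 \<in> \<phi> ` X" using X(3) \<psi>0 by force
    moreover have "\<phi> w \<in> \<phi> ` X" using w by simp
    moreover have "A < norm (\<phi> w)"
    proof -
      have "r * norm (\<phi> w) = dist z w" using d\<psi>[of 0 "\<phi> w"] \<psi>0 inv by simp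
      with w(2) have "r * A < r * norm (\<phi> w)" by (simp add: mult.commute)
      then show ?thesis using r by simp
    qed
    moreover have "\<exists>p\<in>\<phi> ` X. norm p < 1 \<and> \<epsilon> \<le> infdist p (span {b})" if "b \<noteq> 0" for b
    proof -
      let ?L = "(+) z ` span {b}"
      have "aff_dim ?L = 1"
        using that by (simp add: aff_dim_translation_eq aff_dim_subspace dim_insert)
      moreover have "affine ?L" by (simp add: affine_translation[symmetric] subspace_imp_affine)
      ultimately obtain p where p: "p \<in> X" "dist z p < r" "\<epsilon> * r \<le> infdist p ?L" using far by blast
      have "\<epsilon> \<le> infdist (\<phi> p) (span {b})"
      proof -
        have "\<epsilon> \<le> dist (\<phi> p) s" if "s \<in> span {b}" for s
        proof -
          have "\<psi> s \<in> ?L" using that by (auto simp: \<psi>_def span_mul)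
          then have "\<epsilon> * r \<le> dist p (\<psi> s)" using infdist_le[of "\<psi> s" ?L p] p(3) by linarith
          then show ?thesis using d\<psi>[of "\<phi> p" s] inv r by (simp add: mult.commute)
        qed
        then show ?thesis unfolding infdist_def using span_zero by (auto intro!: cINF_greatest)
      qed
      moreover have "r * norm (\<phi> p) < r" using d\<psi>[of 0 "\<phi> p"] \<psi>0 inv p(2) by simp
      then have "norm (\<phi> p) < 1" using r by simp
      ultimately show ?thesis using p(1) by blast
    qed
    ultimately have "\<exists>e\<in>D. \<exists>u. \<forall>t\<in>{u..u+h}. overlapping_level \<delta> (\<phi> ` X \<inter> cball 0 A) e t"
      by (rule unit)
    then obtain e u where eu: "e \<in> D"
      "\<And>t. t \<in> {u..u+h} \<Longrightarrow> overlapping_level \<delta> (\<phi> ` X \<inter> cball 0 A) e t" by blast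
    show "\<exists>e\<in>D. \<exists>u. \<forall>t\<in>{u..u+h*r}. overlapping_level (\<delta>*r) (X \<inter> cball z (A*r)) e t"
    proof (intro bexI[OF _ eu(1)] exI[of _ "e \<bullet> z + r * u"] ballI)
      fix t assume t: "t \<in> {e \<bullet> z + r * u..e \<bullet> z + r * u + h * r}"
      have "(t - e \<bullet> z) / r \<in> {u..u+h}" using t r by (auto simp: field_simps)
      from eu(2)[OF this] obtain p q where "p \<in> \<phi> ` X \<inter> cball 0 A" "q \<in> \<phi> ` X \<inter> cball 0 A"
        "e \<bullet> p = (t - e \<bullet> z) / r" "e \<bullet> q = (t - e \<bullet> z) / r" "\<delta> \<le> dist p q"
        unfolding overlapping_level_def by blast
      then have pq: "p \<in> \<phi> ` X" "q \<in> \<phi> ` X" "norm p \<le> A" "norm q \<le> A"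
        "e \<bullet> p = (t - e \<bullet> z) / r" "e \<bullet> q = (t - e \<bullet> z) / r" "\<delta> \<le> dist p q"
        by auto
      have "\<psi> p \<in> X \<inter> cball z (A * r)" "\<psi> q \<in> X \<inter> cball z (A * r)"
        using pq(1-4) Y r d\<psi>[of 0 p] d\<psi>[of 0 q] \<psi>0 by (auto simp: mult.commute)
      moreover have "e \<bullet> \<psi> p = t" "e \<bullet> \<psi> q = t"
        using pq(5,6) r by (auto simp: \<psi>_def inner_add_right)
      moreover have "\<delta> * r \<le> dist (\<psi> p) (\<psi> q)" using pq(7) r d\<psi> by (simp add: mult.commute)
      ultimately show "overlapping_level (\<delta>*r) (X \<inter> cball z (A*r)) e t"
        unfolding overlapping_level_def by blast
    qed
  qed (use * in auto)
qed

section \<open>Scales at which a finite set splits\<close>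

definition separated_by :: "real \<Rightarrow> 'a::metric_space set \<Rightarrow> bool" where
  "separated_by s N \<longleftrightarrow> (\<forall>x\<in>N. \<forall>y\<in>N. x \<noteq> y \<longrightarrow> s \<le> dist x y)"

lemma extend_to_net:
  assumes "finite P" "N \<subseteq> P" "separated_by s N" "0 < s"
  shows "\<exists>M. N \<subseteq> M \<and> M \<subseteq> P \<and> separated_by s M \<and> (\<forall>p\<in>P. \<exists>x\<in>M. dist p x < s)"
proof -
  let ?\<M> = "{M. N \<subseteq> M \<and> M \<subseteq> P \<and> separated_by s M}"
  have fin: "finite ?\<M>" using assms(1) by (auto intro: finite_subset[of _ "Pow P"])
  have "N \<in> ?\<M>" using assms by auto
  from finite_has_maximal2[OF fin this] obtain M
    where M: "M \<in> ?\<M>" and max: "\<forall>M'\<in>?\<M>. M \<subseteq> M' \<longrightarrow> M = M'"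
    by (elim bexE conjE)
  have "\<exists>x\<in>M. dist p x < s" if "p \<in> P" for p
  proof (rule ccontr)
    assume "\<not> ?thesis"
    then have far: "\<forall>x\<in>M. s \<le> dist p x" by force
    then have "insert p M \<in> ?\<M>"
      using M that by (auto simp: separated_by_def dist_commute)
    then have "p \<in> M" using max by blast
    with far \<open>0 < s\<close> show False by force
  qed
  with M show ?thesis by blast
qed

text \<open>
  Nested nets give every point of \<open>P\<close> that occurs in some net a first scale at which it occurs. The
  counting lemma below charges to these first scales.
\<close>
lemma nested_nets:
  fixes P :: "'a::metric_space set"
  assumes "finite P" "0 < \<sigma>"
  shows "\<exists>N. (\<forall>i j. i \<le> j \<longrightarrow> N i \<subseteq> N j) \<and>
    (\<forall>j. N j \<subseteq> P \<and> separated_by (\<sigma> / 2^j) (N j) \<and> (\<forall>p\<in>P. \<exists>x\<in>N j. dist p x < \<sigma> / 2^j))"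
proof -
  let ?net = "\<lambda>j M. M \<subseteq> P \<and> separated_by (\<sigma> / 2^j) M \<and> (\<forall>p\<in>P. \<exists>x\<in>M. dist p x < \<sigma> / 2^j)"
  have "\<exists>N. \<forall>j. ?net j (N j) \<and> N j \<subseteq> N (Suc j)"
  proof (rule dependent_nat_choice)
    show "\<exists>M. ?net 0 M"
      using extend_to_net[OF assms(1), of "{}" "\<sigma> / 2^0"] assms(2) by (auto simp: separated_by_def)
    fix M j assume M: "?net j M"
    have le: "\<sigma> / 2 ^ Suc j \<le> \<sigma> / 2 ^ j" using assms(2) by (simp add: field_simps)
    have "separated_by (\<sigma> / 2 ^ Suc j) M"
      using M order_trans[OF le] unfolding separated_by_def by blast
    then show "\<exists>M'. ?net (Suc j) M' \<and> M \<subseteq> M'"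
      using extend_to_net[OF assms(1), of M "\<sigma> / 2 ^ Suc j"] M assms(2) by auto
  qed
  then obtain N where N: "\<And>j. ?net j (N j)" "\<And>j. N j \<subseteq> N (Suc j)" by blast
  have "N i \<subseteq> N j" if "i \<le> j" for i j using N(2) that by (rule lift_Suc_mono_le)
  with N(1) show ?thesis by blast
qed

text \<open>
  Suppose that the ball around \<open>z\<close> of radius \<open>A / 2\<^sup>n\<close> contains two points of \<open>P\<close> at distance at
  least \<open>\<delta> / 2\<^sup>n\<close>. The net of scale \<open>n\<close> contains two different points close to them, while the net
  that is coarser by \<open>a\<close> scales contains at most one of these, its points being too far apart. So one of
  them enters the nets at one of the \<open>a\<close> scales up to \<open>n\<close>, and the pair \<open>(n, z)\<close> is charged to it. Each
  point of \<open>P\<close> is charged at most \<open>a * M\<close> times.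
\<close>
lemma card_splitting_scales_le:
  fixes P :: "'a::metric_space set" and Z :: "nat \<Rightarrow> 'a set"
  assumes P: "finite P" and \<delta>: "0 < \<delta>" and A: "0 \<le> A"
    and a: "8 * (A + \<delta>) < 2 ^ a * \<delta>"
    and Z: "\<And>n. finite (Z n)" "\<And>n v. card {z \<in> Z n. dist v z \<le> (A + \<delta>) / 2^n} \<le> M"
  shows "card {(n, z). n \<in> J \<and> z \<in> Z n \<and> (\<exists>p\<in>P. \<exists>q\<in>P. dist p z \<le> A / 2^n \<and> dist q z \<le> A / 2^n
           \<and> \<delta> / 2^n \<le> dist p q)} \<le> a * M * card P" (is "card ?S \<le> _")
proof -
  have "0 < \<delta>/4" using \<delta> by simp
  from nested_nets[OF P this] obtain N where "\<forall>i j. i \<le> j \<longrightarrow> N i \<subseteq> N j"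
    and N: "\<forall>j. N j \<subseteq> P \<and> separated_by ((\<delta>/4) / 2^j) (N j) \<and> (\<forall>p\<in>P. \<exists>x\<in>N j. dist p x < (\<delta>/4) / 2^j)"
    by (elim exE conjE)
  then have mono: "\<And>i j. i \<le> j \<Longrightarrow> N i \<subseteq> N j" by simp
  have sep: "\<And>j. separated_by ((\<delta>/4) / 2^j) (N j)" and sub: "\<And>j. N j \<subseteq> P"
    and dense: "\<And>j p. p \<in> P \<Longrightarrow> \<exists>x\<in>N j. dist p x < (\<delta>/4) / 2^j"
    using N by simp_all
  define l where "l v = (LEAST j. v \<in> N j)" for v
  let ?B = "\<lambda>v n. {z \<in> Z n. dist v z \<le> (A + \<delta>) / 2^n}"
  let ?U = "\<Union>v\<in>P. SIGMA n:{l v..<l v + a}. ?B v n"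
  have "?S \<subseteq> ?U"
  proof clarify
    fix n z p q
    assume z: "z \<in> Z n" and pq: "p \<in> P" "q \<in> P" "dist p z \<le> A / 2^n" "dist q z \<le> A / 2^n" "\<delta> / 2^n \<le> dist p q"
    obtain p' where p': "p' \<in> N n" "dist p p' < (\<delta>/4) / 2^n" using dense pq by blast
    obtain q' where q': "q' \<in> N n" "dist q q' < (\<delta>/4) / 2^n" using dense pq by blast
    have \<delta>n: "0 < \<delta> / 2^n" "(\<delta>/4) / 2^n = (\<delta> / 2^n) / 4" "(A + \<delta>) / 2^n = A / 2^n + \<delta> / 2^n"
      using \<delta> by (auto simp: add_divide_distrib)
    have ne: "p' \<noteq> q'" using pq(5) p'(2) q'(2) dist_triangle2[of p q p'] \<delta>n by auto
    have close: "dist p' z \<le> (A + \<delta>) / 2^n" "dist q' z \<le> (A + \<delta>) / 2^n"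
      using dist_triangle3[of p' z p] p'(2) pq(3) dist_triangle3[of q' z q] q'(2) pq(4) \<delta>n by linarith+
    have "\<exists>v\<in>{p',q'}. n < a \<or> v \<notin> N (n - a)"
    proof (rule ccontr)
      assume "\<not> ?thesis"
      then have na: "a \<le> n" and "p' \<in> N (n - a)" "q' \<in> N (n - a)" by auto
      then have "(\<delta>/4) / 2^(n - a) \<le> dist p' q'" using sep ne unfolding separated_by_def by blast
      also have "\<dots> \<le> dist p' z + dist q' z" by (rule dist_triangle2)
      also have "\<dots> \<le> 2 * ((A + \<delta>) / 2^n)" using close by linarith
      also have "(\<delta>/4) / 2^(n - a) = (2^a * \<delta>) / 4 / 2^n" using na by (simp add: power_diff)
      finally have "2^a * \<delta> \<le> 8 * (A + \<delta>)" by (simp add: field_simps)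
      with a show False by simp
    qed
    then obtain v where v: "v \<in> {p', q'}" "n < a \<or> v \<notin> N (n - a)" by blast
    have vN: "v \<in> N n" using v(1) p' q' by auto
    then have "l v \<le> n" "v \<in> N (l v)" unfolding l_def by (auto intro: Least_le LeastI)
    moreover have "n < l v + a"
    proof (rule ccontr)
      assume "\<not> n < l v + a"
      then have "l v \<le> n - a" "a \<le> n" by auto
      with mono[of "l v" "n - a"] \<open>v \<in> N (l v)\<close> v(2) show False by auto
    qed
    moreover have "v \<in> P" using vN sub by blast
    moreover have "z \<in> ?B v n" using v(1) close z by auto
    ultimately show "(n, z) \<in> ?U" by auto
  qed
  moreover have fin: "finite ?U" using P Z(1) by (auto intro!: finite_SigmaI)
  ultimately have "card ?S \<le> card ?U" by (intro card_mono)
  also have "\<dots> \<le> (\<Sum>v\<in>P. card (SIGMA n:{l v..<l v + a}. ?B v n))"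
    by (rule card_UN_le[OF P])
  also have "\<dots> \<le> (\<Sum>v\<in>P. a * M)"
  proof (rule sum_mono)
    fix v
    have "card (SIGMA n:{l v..<l v + a}. ?B v n) = (\<Sum>n\<in>{l v..<l v + a}. card (?B v n))"
      using Z(1) by (intro card_SigmaI) auto
    also have "\<dots> \<le> (\<Sum>n\<in>{l v..<l v + a}. M)" using Z(2) by (intro sum_mono)
    finally show "card (SIGMA n:{l v..<l v + a}. ?B v n) \<le> a * M" by simp
  qed
  finally show ?thesis by (simp add: mult.commute)
qed

section \<open>Counting overlaps with a weighted finite set\<close>

lemma sum_indicator_card:
  assumes "finite G"
  shows "(\<Sum>g\<in>G. indicator (T g) t :: ennreal) = of_nat (card {g \<in> G. t \<in> T g})"
  using assms by (simp add: indicator_def sum.If_cases Int_def)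

text \<open>
  For each direction \<open>e\<close> in \<open>D\<close>, a point \<open>x\<close> of \<open>S\<close> casts a shadow of length \<open>4 \<Lambda> \<rho> x\<close> on the
  real line. A level \<open>t\<close> on which two points of \<open>X\<close> near \<open>z\<close> overlap lies in the shadows of two points of
  \<open>S\<close> that are still separated at the scale of \<open>z\<close>. By \<open>card_splitting_scales_le\<close> this happens at
  \<open>t\<close> for at most \<open>a * M\<close> times as many pairs \<open>(n, z)\<close> as there are shadows over \<open>t\<close>. Integrating over
  \<open>t\<close> gives the bound.
\<close>
lemma overlap_scale_sum_le:
  fixes X S D :: "'a::euclidean_space set" and Z :: "nat \<Rightarrow> 'a set"
    and \<rho> :: "'a \<Rightarrow> real" and \<Lambda> A \<delta> h :: real and a M :: nat
  assumes D: "finite D" "\<And>e. e \<in> D \<Longrightarrow> norm e \<le> \<Lambda>" "0 \<le> \<Lambda>"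
    and S: "finite S" "\<And>x. x \<in> S \<Longrightarrow> 0 \<le> \<rho> x"
    and J: "finite J" and Z: "\<And>n. finite (Z n)"
    and mult: "\<And>n v. card {z \<in> Z n. dist v z \<le> (A + \<delta> + \<delta>/2) / 2^n} \<le> M"
    and pos: "0 \<le> A" "0 < \<delta>" "0 < h"
    and a: "8 * (A + \<delta> + \<delta>/2) < 2 ^ a * (\<delta>/2)"
    and over: "\<And>n z. n \<in> J \<Longrightarrow> z \<in> Z n \<Longrightarrow>
      \<exists>e\<in>D. \<exists>u. \<forall>t\<in>{u..u+h/2^n}. overlapping_level (\<delta>/2^n) (X \<inter> cball z (A/2^n)) e t"
    and near: "\<And>n z p. n \<in> J \<Longrightarrow> z \<in> Z n \<Longrightarrow> p \<in> X \<Longrightarrow> dist z p \<le> A/2^n \<Longrightarrow>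
      \<exists>x\<in>S. dist p x \<le> 2 * \<rho> x \<and> dist p x \<le> \<delta>/4/2^n"
  shows "(\<Sum>n\<in>J. \<Sum>z\<in>Z n. h/2^n) \<le> card D * (a * M) * (4 * \<Lambda> * (\<Sum>x\<in>S. \<rho> x))"
proof -
  let ?K = "a * M"
  \<comment> \<open>\<open>I e x\<close> is the shadow of \<open>x\<close>; \<open>W g\<close> lists the separated pairs near the centre of \<open>g = (n, z)\<close>.\<close>
  define I where "I e x = {e \<bullet> x - 2 * \<Lambda> * \<rho> x..e \<bullet> x + 2 * \<Lambda> * \<rho> x}" for e x
  define W where "W g = {(x, y) \<in> S \<times> S. dist x (snd g) \<le> (A + \<delta>) / 2^fst g \<and>
    dist y (snd g) \<le> (A + \<delta>) / 2^fst g \<and> (\<delta>/2) / 2^fst g \<le> dist x y}" for g :: "nat \<times> 'a"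
  define T where "T e g = (\<Union>(x, y)\<in>W g. I e x \<inter> I e y)" for e g
  define G where "G = Sigma J Z"
  have finG: "finite G" using J Z by (auto simp: G_def)
  have finW: "finite (W g)" for g
    by (rule finite_subset[of _ "S \<times> S"]) (use S in \<open>auto simp: W_def\<close>)
  have T_sets: "T e g \<in> sets lborel" for e g
    unfolding T_def I_def using finW by (intro sets.finite_UN) auto
  have Ilen: "emeasure lborel (I e x) = ennreal (4 * \<Lambda> * \<rho> x)" if "x \<in> S" for e x
    using S(2)[OF that] D(3) by (simp add: I_def)
  have cover: "\<exists>e\<in>D. ennreal (h/2^n) \<le> emeasure lborel (T e (n, z))" if nz: "n \<in> J" "z \<in> Z n" for n z
  proof -
    from over[OF nz] obtain e u where e: "e \<in> D"
      and lev: "\<And>t. t \<in> {u..u+h/2^n} \<Longrightarrow> overlapping_level (\<delta>/2^n) (X \<inter> cball z (A/2^n)) e t" by blast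
    have \<delta>n: "0 < \<delta> / 2^n" "\<delta>/4/2^n = (\<delta> / 2^n) / 4" "(\<delta>/2)/2^n = (\<delta> / 2^n) / 2" "(A + \<delta>) / 2^n = A / 2^n + \<delta> / 2^n"
      using pos by (auto simp: add_divide_distrib)
    have "{u..u+h/2^n} \<subseteq> T e (n, z)"
    proof
      fix t assume "t \<in> {u..u+h/2^n}"
      from lev[OF this] obtain p q where "p \<in> X \<inter> cball z (A/2^n)" "q \<in> X \<inter> cball z (A/2^n)"
        and t: "e \<bullet> p = t" "e \<bullet> q = t" and pq: "\<delta>/2^n \<le> dist p q"
        unfolding overlapping_level_def by blast
      then have p: "p \<in> X" "dist z p \<le> A/2^n" and q: "q \<in> X" "dist z q \<le> A/2^n" by auto
      from near[OF nz p] obtain x where x: "x \<in> S" "dist p x \<le> 2 * \<rho> x" "dist p x \<le> \<delta>/4/2^n"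
        by (elim bexE conjE)
      from near[OF nz q] obtain y where y: "y \<in> S" "dist q y \<le> 2 * \<rho> y" "dist q y \<le> \<delta>/4/2^n"
        by (elim bexE conjE)
      have inI: "t \<in> I e x'" if "e \<bullet> p' = t" "dist p' x' \<le> 2 * \<rho> x'" for p' x'
      proof -
        have "\<bar>e \<bullet> (p' - x')\<bar> \<le> norm e * norm (p' - x')" by (rule Cauchy_Schwarz_ineq2)
        also have "\<dots> \<le> \<Lambda> * (2 * \<rho> x')"
          using that D(2)[OF e] D(3) by (intro mult_mono) (auto simp: dist_norm)
        finally show ?thesis using that(1) by (auto simp: I_def inner_diff_right abs_le_iff)
      qed
      have "(x, y) \<in> W (n, z)"
        using x y p(2) q(2) pq \<delta>n dist_triangle3[of x z p] dist_triangle3[of y z q]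
          dist_triangle[of p q x] dist_triangle[of x q y]
        by (auto simp: W_def dist_commute)
      then show "t \<in> T e (n, z)"
        unfolding T_def using inI[OF t(1) x(2)] inI[OF t(2) y(2)] by blast
    qed
    then have "emeasure lborel {u..u+h/2^n} \<le> emeasure lborel (T e (n, z))"
      using T_sets by (intro emeasure_mono)
    then show ?thesis using e pos by auto
  qed
  have count: "(\<Sum>g\<in>G. indicator (T e g) t) \<le> (of_nat ?K * (\<Sum>x\<in>S. indicator (I e x) t) :: ennreal)" for e t
  proof -
    let ?F = "{x \<in> S. t \<in> I e x}"
    let ?B = "{(n, z). n \<in> J \<and> z \<in> Z n \<and> (\<exists>p\<in>?F. \<exists>q\<in>?F.
        dist p z \<le> (A + \<delta>) / 2^n \<and> dist q z \<le> (A + \<delta>) / 2^n \<and> (\<delta>/2) / 2^n \<le> dist p q)}"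
    have "?B \<subseteq> G" unfolding G_def by blast
    then have "finite ?B" using finG by (rule finite_subset)
    moreover have "{g \<in> G. t \<in> T e g} \<subseteq> ?B"
    proof
      fix g assume g: "g \<in> {g \<in> G. t \<in> T e g}"
      then have "\<exists>w\<in>W g. t \<in> I e (fst w) \<inter> I e (snd w)" unfolding T_def by (simp add: split_beta)
      then obtain x y where xy: "(x, y) \<in> W g" "t \<in> I e x" "t \<in> I e y" by force
      obtain n z where nz: "g = (n, z)" by (cases g)
      have "n \<in> J" "z \<in> Z n" using g nz by (auto simp: G_def)
      moreover have "x \<in> ?F" "y \<in> ?F" using xy by (auto simp: W_def)
      moreover have "dist x z \<le> (A + \<delta>) / 2^n" "dist y z \<le> (A + \<delta>) / 2^n" "(\<delta>/2) / 2^n \<le> dist x y"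
        using xy(1) nz by (auto simp: W_def)
      ultimately show "g \<in> ?B" unfolding nz by blast
    qed
    ultimately have "card {g \<in> G. t \<in> T e g} \<le> card ?B" by (rule card_mono)
    also have "\<dots> \<le> ?K * card ?F"
      by (rule card_splitting_scales_le[OF _ _ _ a Z mult]) (use S pos in auto)
    finally have "(of_nat (card {g \<in> G. t \<in> T e g}) :: ennreal) \<le> of_nat (?K * card ?F)"
      by (rule of_nat_mono)
    then show ?thesis by (simp only: sum_indicator_card[OF finG] sum_indicator_card[OF S(1)] of_nat_mult)
  qed
  have "(\<Sum>n\<in>J. \<Sum>z\<in>Z n. h/2^n) = (\<Sum>g\<in>G. h/2^fst g)"
    unfolding G_def by (subst sum.Sigma) (use J Z in \<open>auto simp: split_beta\<close>)
  then have "ennreal (\<Sum>n\<in>J. \<Sum>z\<in>Z n. h/2^n) = (\<Sum>g\<in>G. ennreal (h/2^fst g))"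
    using pos by (simp add: sum_ennreal)
  also have "\<dots> \<le> (\<Sum>g\<in>G. \<Sum>e\<in>D. emeasure lborel (T e g))"
  proof (rule sum_mono)
    fix g assume "g \<in> G"
    then obtain e where e: "e \<in> D" "ennreal (h/2^fst g) \<le> emeasure lborel (T e g)"
      using cover[of "fst g" "snd g"] by (auto simp: G_def)
    note e(2)
    also have "emeasure lborel (T e g) \<le> (\<Sum>e\<in>D. emeasure lborel (T e g))"
      by (rule member_le_sum) (use e D in auto)
    finally show "ennreal (h/2^fst g) \<le> (\<Sum>e\<in>D. emeasure lborel (T e g))" .
  qed
  also have "\<dots> = (\<Sum>e\<in>D. \<Sum>g\<in>G. emeasure lborel (T e g))" by (rule sum.swap)
  also have "\<dots> \<le> (\<Sum>e\<in>D. ennreal (real ?K * (4 * \<Lambda> * (\<Sum>x\<in>S. \<rho> x))))"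
  proof (rule sum_mono)
    fix e
    have "(\<Sum>g\<in>G. emeasure lborel (T e g)) = (\<integral>\<^sup>+t. (\<Sum>g\<in>G. indicator (T e g) t) \<partial>lborel)"
      using T_sets by (subst nn_integral_sum) auto
    also have "\<dots> \<le> (\<integral>\<^sup>+t. of_nat ?K * (\<Sum>x\<in>S. indicator (I e x) t) \<partial>lborel)"
      using count by (intro nn_integral_mono) auto
    also have "\<dots> = of_nat ?K * (\<Sum>x\<in>S. emeasure lborel (I e x))"
      by (subst nn_integral_cmult) (auto simp: I_def nn_integral_sum)
    also have "\<dots> = of_nat ?K * ennreal (\<Sum>x\<in>S. 4 * \<Lambda> * \<rho> x)"
      using Ilen S D(3) by (simp add: sum_ennreal)
    also have "\<dots> = ennreal (real ?K * (4 * \<Lambda> * (\<Sum>x\<in>S. \<rho> x)))"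
      using S D(3) by (simp add: sum_distrib_left ennreal_of_nat_eq_real_of_nat ennreal_mult[symmetric] sum_nonneg)
    finally show "(\<Sum>g\<in>G. emeasure lborel (T e g)) \<le> ennreal (real ?K * (4 * \<Lambda> * (\<Sum>x\<in>S. \<rho> x)))" .
  qed
  also have "\<dots> = ennreal (card D * ?K * (4 * \<Lambda> * (\<Sum>x\<in>S. \<rho> x)))"
    by (simp add: ennreal_of_nat_eq_real_of_nat ennreal_mult'[symmetric] mult.assoc)
  finally show ?thesis
    using S D(3) by (subst (asm) ennreal_le_iff) (auto intro!: mult_nonneg_nonneg sum_nonneg)
qed

section \<open>Finite nets adapted to a set of positive lower density\<close>

lemma doubling_iterate:
  fixes \<mu> :: "'a::real_normed_vector measure"
  assumes C: "0 < C"
    and doubling: "\<And>r. 0 < r \<Longrightarrow> emeasure \<mu> (ball x (2 * r)) \<le> ennreal C * emeasure \<mu> (ball x r)"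
    and r: "0 < r"
  shows "emeasure \<mu> (ball x (2^k * r)) \<le> ennreal (C^k) * emeasure \<mu> (ball x r)"
proof (induction k)
  case (Suc k)
  have "emeasure \<mu> (ball x (2 * (2^k * r))) \<le> ennreal C * emeasure \<mu> (ball x (2^k * r))"
    using r by (intro doubling) auto
  also have "\<dots> \<le> ennreal C * (ennreal (C^k) * emeasure \<mu> (ball x r))"
    by (intro mult_left_mono Suc.IH) auto
  finally show ?case using C by (simp add: mult.assoc[symmetric] ennreal_mult[symmetric])
qed (use r in simp)

lemma infdist_lessE:
  assumes "infdist x E < r" "E \<noteq> {}"
  obtains z where "z \<in> E" "dist x z < r"
  using assms cINF_less_iff[of E "dist x" r] by (auto simp: infdist_notempty)

text \<open>
  The radius \<open>\<rho>\<close> is a Lipschitz function with constant \<open>\<eta> \<le> 1/2\<close>, so the radii of neighbouring net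
  points are comparable. For a point \<open>x\<close> near \<open>E\<close> the ball of radius \<open>\<rho>(x)/2\<close> has mass at least
  a multiple of \<open>\<rho>(x)\<close>: a point of \<open>E\<close> lies at a distance of at most \<open>2 \<rho>(x)/\<eta>\<close>, and doubling
  compares the balls around \<open>x\<close> of radii \<open>\<rho>(x)/2\<close> and \<open>3 \<rho>(x)/\<eta>\<close>. Disjointness of the small balls bounds
  the sum of the radii, hence also the size of a separated set, so a largest separated set
  exists. The bound \<open>C0\<close> does not depend on the cutoff \<open>s\<close>, which only serves to make the net finite.
\<close>
lemma adapted_net:
  fixes \<mu> :: "'a::euclidean_space measure"
  assumes sets: "sets \<mu> = sets borel" and fin: "\<And>x r. emeasure \<mu> (ball x r) < \<infinity>"
    and C: "0 < C"
    and doubling: "\<And>x r. x \<in> X \<Longrightarrow> 0 < r \<Longrightarrow>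
      emeasure \<mu> (ball x (2 * r)) \<le> ennreal C * emeasure \<mu> (ball x r)"
    and E: "E \<noteq> {}" "bounded E"
    and lower: "\<And>z r. z \<in> E \<Longrightarrow> 0 < r \<Longrightarrow> r < r0 \<Longrightarrow> ennreal (c * r) \<le> emeasure \<mu> (ball z r)"
    and c: "0 < c" and \<eta>: "0 < \<eta>" "\<eta> \<le> 1/2"
  shows "\<exists>C0. \<forall>s \<rho>. 0 < s \<and> s < r0 \<and> \<rho> = (\<lambda>p. \<eta> * max s (infdist p E)) \<longrightarrow>
    (\<exists>S. finite S \<and> (\<Sum>x\<in>S. \<rho> x) \<le> C0 \<and>
      (\<forall>p\<in>X. infdist p E < r0 \<longrightarrow> (\<exists>x\<in>S. dist p x \<le> 2 * \<rho> x \<and> dist p x \<le> 2 * \<rho> p)))"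
proof -
  obtain b where b: "\<And>z. z \<in> E \<Longrightarrow> norm z \<le> b" using E(2) by (auto simp: bounded_iff)
  obtain k :: nat where k: "6 / \<eta> < 2^k" using real_arch_pow[of 2 "6 / \<eta>"] by auto
  define \<kappa> where "\<kappa> = \<eta> * C^k / c"
  define V where "V = measure \<mu> (ball 0 (b + 2 * r0))"
  have \<kappa>: "0 < \<kappa>" using C c \<eta> by (simp add: \<kappa>_def)
  have fin': "emeasure \<mu> (ball x r) \<noteq> \<infinity>" for x r using fin[of x r] by auto
  have meas: "A \<in> sets \<mu>" if "open A" for A using that sets by auto
  show ?thesis
  proof (intro exI[of _ "\<kappa> * V"] allI impI)
    fix s \<rho> assume "0 < s \<and> s < r0 \<and> \<rho> = (\<lambda>p. \<eta> * max s (infdist p E))"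
    then have s: "0 < s" "s < r0" and \<rho>: "\<And>p. \<rho> p = \<eta> * max s (infdist p E)" by auto
    define Y where "Y = {x \<in> X. infdist x E < r0}"
    have \<rho>s: "\<eta> * s \<le> \<rho> p" for p using \<eta> by (simp add: \<rho>)
    have \<rho>0: "0 < \<rho> p" for p using \<rho>s[of p] \<eta> s by (smt (verit) mult_pos_pos)
    have mass: "\<rho> x \<le> \<kappa> * measure \<mu> (ball x (\<rho> x / 2))" if "x \<in> Y" for x
    proof -
      define m where "m = max s (infdist x E)"
      have m: "0 < m" "m < r0" "infdist x E < 2 * m" using s that by (auto simp: m_def Y_def)
      obtain z where z: "z \<in> E" "dist x z < 2 * m" using infdist_lessE[OF m(3) E(1)] .
      have "3 * m \<le> 2^k * (\<rho> x / 2)"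
      proof -
        have "6 \<le> 2^k * \<eta>" using k \<eta> by (simp add: field_simps)
        then have "6 * m \<le> 2^k * \<eta> * m" using m by (intro mult_right_mono) auto
        then show ?thesis by (simp add: \<rho> m_def)
      qed
      moreover have "ball z m \<subseteq> ball x (3 * m)"
        using z(2) by (smt (verit) dist_triangle mem_ball subsetI)
      ultimately have sub: "ball z m \<subseteq> ball x (2^k * (\<rho> x / 2))" by (meson order_trans subset_ball)
      have "ennreal (c * m) \<le> emeasure \<mu> (ball z m)" using lower[OF z(1) m(1,2)] .
      also have "\<dots> \<le> emeasure \<mu> (ball x (2^k * (\<rho> x / 2)))" using sub meas by (intro emeasure_mono) auto
      also have "\<dots> \<le> ennreal (C^k) * emeasure \<mu> (ball x (\<rho> x / 2))"
        using \<rho>0[of x] that doubling by (intro doubling_iterate[OF C]) (auto simp: Y_def)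
      also have "\<dots> = ennreal (C^k * measure \<mu> (ball x (\<rho> x / 2)))"
        using C by (simp add: emeasure_eq_ennreal_measure[OF fin'[unfolded infinity_ennreal_def]] ennreal_mult)
      finally have "c * m \<le> C^k * measure \<mu> (ball x (\<rho> x / 2))"
        using C by (subst (asm) ennreal_le_iff) auto
      then have "m \<le> C^k * measure \<mu> (ball x (\<rho> x / 2)) / c" using c by (simp add: field_simps)
      then have "\<eta> * m \<le> \<eta> * (C^k * measure \<mu> (ball x (\<rho> x / 2)) / c)" using \<eta> by (intro mult_left_mono) auto
      then show ?thesis by (simp add: \<rho> m_def \<kappa>_def mult_ac)
    qed
    let ?sep = "\<lambda>S. finite S \<and> S \<subseteq> Y \<and> (\<forall>x\<in>S. \<forall>y\<in>S. x \<noteq> y \<longrightarrow> max (\<rho> x) (\<rho> y) \<le> dist x y)"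
    have total: "(\<Sum>x\<in>S. \<rho> x) \<le> \<kappa> * V" if S: "?sep S" for S
    proof -
      have disj: "disjoint_family_on (\<lambda>x. ball x (\<rho> x / 2)) S"
        unfolding disjoint_family_on_def
      proof (intro ballI impI)
        fix x y assume "x \<in> S" "y \<in> S" "x \<noteq> y"
        then have "\<rho> x / 2 + \<rho> y / 2 \<le> dist x y" using S by (smt (verit) field_sum_of_halves max_def)
        then show "ball x (\<rho> x / 2) \<inter> ball y (\<rho> y / 2) = {}" by (rule disjoint_ballI)
      qed
      have inside: "(\<Union>x\<in>S. ball x (\<rho> x / 2)) \<subseteq> ball 0 (b + 2 * r0)"
      proof clarify
        fix x y assume "x \<in> S" and y: "y \<in> ball x (\<rho> x / 2)"
        then have x: "infdist x E < r0" using S by (auto simp: Y_def)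
        obtain z where z: "z \<in> E" "dist x z < r0" using infdist_lessE[OF x E(1)] .
        have "\<rho> x \<le> (1/2) * r0" unfolding \<rho> using \<eta> s x by (intro mult_mono) auto
        moreover have "norm y \<le> norm z + dist x z + dist x y"
          using norm_triangle_sub[of y x] norm_triangle_sub[of x z]
          by (simp add: dist_norm norm_minus_commute)
        ultimately show "y \<in> ball 0 (b + 2 * r0)" using b[OF z(1)] z(2) y s by simp
      qed
      have "(\<Sum>x\<in>S. \<rho> x) \<le> (\<Sum>x\<in>S. \<kappa> * measure \<mu> (ball x (\<rho> x / 2)))"
        using mass S by (intro sum_mono) auto
      also have "\<dots> = \<kappa> * (\<Sum>x\<in>S. measure \<mu> (ball x (\<rho> x / 2)))" by (simp add: sum_distrib_left)
      also have "(\<Sum>x\<in>S. measure \<mu> (ball x (\<rho> x / 2))) = measure \<mu> (\<Union>x\<in>S. ball x (\<rho> x / 2))"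
        using S meas fin' disj by (intro measure_finite_Union[symmetric]) auto
      also have "\<dots> \<le> V" unfolding V_def
        using inside fin[of 0 "b + 2 * r0"]
        by (intro measure_mono_fmeasurable meas open_UN) (auto simp: fmeasurable_def intro: meas)
      finally show ?thesis using \<kappa> by simp
    qed
    have "\<exists>S. ?sep S \<and> (\<forall>S'. ?sep S' \<longrightarrow> card S' \<le> card S)"
    proof -
      have "\<forall>S. ?sep S \<longrightarrow> card S < Suc (nat \<lfloor>\<kappa> * V / (\<eta> * s)\<rfloor>)"
      proof (intro allI impI)
        fix S assume S: "?sep S"
        have "card S * (\<eta> * s) \<le> (\<Sum>x\<in>S. \<rho> x)" using \<rho>s by (simp add: sum_bounded_below)
        also have "\<dots> \<le> \<kappa> * V" using total[OF S] .
        finally have "real (card S) \<le> \<kappa> * V / (\<eta> * s)" using \<eta> s by (simp add: field_simps)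
        then show "card S < Suc (nat \<lfloor>\<kappa> * V / (\<eta> * s)\<rfloor>)" by linarith
      qed
      moreover have "?sep {}" by simp
      ultimately show ?thesis
        using ex_has_greatest_nat[of ?sep "{}" card "Suc (nat \<lfloor>\<kappa> * V / (\<eta> * s)\<rfloor>)"] by iprover
    qed
    then obtain S where S: "?sep S" and max: "\<And>S'. ?sep S' \<Longrightarrow> card S' \<le> card S" by blast
    have "\<exists>x\<in>S. dist p x \<le> 2 * \<rho> x \<and> dist p x \<le> 2 * \<rho> p" if p: "p \<in> X" "infdist p E < r0" for p
    proof -
      have "\<exists>x\<in>S. dist p x < max (\<rho> p) (\<rho> x)"
      proof (rule ccontr)
        assume "\<not> ?thesis"
        then have far: "\<And>x. x \<in> S \<Longrightarrow> max (\<rho> p) (\<rho> x) \<le> dist p x" by force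
        then have "p \<notin> S" using \<rho>0[of p] by fastforce
        moreover have "?sep (insert p S)"
          using S far p by (auto simp: Y_def dist_commute max.commute)
        ultimately show False using max[of "insert p S"] S by simp
      qed
      then obtain x where x: "x \<in> S" "dist p x < max (\<rho> p) (\<rho> x)" by blast
      have "\<bar>\<rho> p - \<rho> x\<bar> \<le> dist p x / 2"
      proof -
        have "\<rho> p - \<rho> x = \<eta> * (max s (infdist p E) - max s (infdist x E))"
          by (simp add: \<rho> right_diff_distrib)
        then have "\<bar>\<rho> p - \<rho> x\<bar> = \<eta> * \<bar>max s (infdist p E) - max s (infdist x E)\<bar>"
          using \<eta> by (simp add: abs_mult)
        also have "\<dots> \<le> (1/2) * dist p x"
          using \<eta> infdist_triangle_abs[of p E x] by (intro mult_mono) auto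
        finally show ?thesis by simp
      qed
      then show ?thesis using x by (intro bexI[OF _ x(1)]) (auto simp: max_def abs_le_iff split: if_splits)
    qed
    then show "\<exists>S. finite S \<and> (\<Sum>x\<in>S. \<rho> x) \<le> \<kappa> * V \<and>
      (\<forall>p\<in>X. infdist p E < r0 \<longrightarrow> (\<exists>x\<in>S. dist p x \<le> 2 * \<rho> x \<and> dist p x \<le> 2 * \<rho> p))"
      using S total[OF S] by blast
  qed
qed

section \<open>Dyadic cubes\<close>

definition dyadic_index :: "nat \<Rightarrow> real ^ 'n \<Rightarrow> 'n \<Rightarrow> int" where
  "dyadic_index n x = (\<lambda>i. \<lfloor>x $ i * 2^n\<rfloor>)"

lemma mem_dyadic_cube_iff: "x \<in> dyadic_cube (int n) k \<longleftrightarrow> k = dyadic_index n x"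
proof -
  have "of_int (k i) * 2 powi (- int n) \<le> x $ i \<and> x $ i < (of_int (k i) + 1) * 2 powi (- int n)
    \<longleftrightarrow> k i = \<lfloor>x $ i * 2^n\<rfloor>" for i
  proof -
    have pw: "(2::real) powi (- int n) = 1 / 2^n" by (simp add: power_int_minus divide_inverse)
    have "of_int (k i) * 2 powi (- int n) \<le> x $ i \<and> x $ i < (of_int (k i) + 1) * 2 powi (- int n)
      \<longleftrightarrow> of_int (k i) \<le> x $ i * 2^n \<and> x $ i * 2^n < of_int (k i) + 1"
      unfolding pw by (simp add: field_simps)
    then show ?thesis using floor_eq_iff[of "x $ i * 2^n" "k i"] by auto
  qed
  then show ?thesis by (auto simp: dyadic_cube_def dyadic_index_def fun_eq_iff)
qed

lemma abs_diff_mult_power: "\<bar>a * 2^n - b * 2^n\<bar> = \<bar>a - b\<bar> * 2^n" for a b :: real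
  by (metis abs_mult abs_of_nonneg left_diff_distrib zero_le_numeral zero_le_power)

text \<open>
  Points in a common ball of radius \<open>B / 2\<^sup>n\<close> have coordinates whose integer parts, after
  scaling by \<open>2\<^sup>n\<close>, differ by at most \<open>\<lceil>B\<rceil> + 1\<close> from those of the centre.
\<close>
lemma dyadic_indices_near:
  fixes v :: "real ^ 'n"
  assumes "0 \<le> B"
  shows "finite (dyadic_index n ` {z. dist v z \<le> B / 2^n})"
    and "card (dyadic_index n ` {z. dist v z \<le> B / 2^n}) \<le> (2 * nat \<lceil>B\<rceil> + 3) ^ CARD('n)"
proof -
  let ?L = "\<lceil>B\<rceil> + 1"
  let ?P = "PiE (UNIV :: 'n set) (\<lambda>i. {dyadic_index n v i - ?L..dyadic_index n v i + ?L})"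
  have sub: "dyadic_index n ` {z. dist v z \<le> B / 2^n} \<subseteq> ?P"
  proof clarify
    fix z assume z: "dist v z \<le> B / 2^n"
    have "dyadic_index n z i \<in> {dyadic_index n v i - ?L..dyadic_index n v i + ?L}" for i
    proof -
      have "\<bar>(v - z) $ i\<bar> \<le> B / 2^n"
        using z component_le_norm_cart[of "v - z" i] by (simp add: dist_norm)
      then have "\<bar>v $ i * 2^n - z $ i * 2^n\<bar> \<le> B"
        unfolding abs_diff_mult_power by (simp add: pos_le_divide_eq)
      then show ?thesis unfolding dyadic_index_def atLeastAtMost_iff by linarith
    qed
    then show "dyadic_index n z \<in> ?P" by auto
  qed
  have "finite ?P" by (intro finite_PiE) auto
  then show "finite (dyadic_index n ` {z. dist v z \<le> B / 2^n})" using sub by (rule finite_subset[rotated])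
  have "card (dyadic_index n ` {z. dist v z \<le> B / 2^n}) \<le> card ?P"
    using sub \<open>finite ?P\<close> by (rule card_mono[rotated])
  also have "card ?P = (\<Prod>i\<in>(UNIV :: 'n set). nat (2 * ?L + 1))" by (simp add: card_PiE)
  also have "\<dots> = (2 * nat \<lceil>B\<rceil> + 3) ^ CARD('n)"
  proof -
    have "0 \<le> \<lceil>B\<rceil>" using assms by simp
    then obtain m where "\<lceil>B\<rceil> = int m" using nonneg_int_cases by blast
    then have "nat (2 * ?L + 1) = 2 * nat \<lceil>B\<rceil> + 3" by simp
    then show ?thesis by simp
  qed
  finally show "card (dyadic_index n ` {z. dist v z \<le> B / 2^n}) \<le> (2 * nat \<lceil>B\<rceil> + 3) ^ CARD('n)" .
qed

lemma finite_dyadic_indices: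
  fixes E :: "(real ^ 'n) set"
  assumes "bounded E"
  shows "finite (dyadic_index n ` E)"
proof -
  obtain b where b: "b > 0" "\<And>z. z \<in> E \<Longrightarrow> norm z \<le> b"
    using assms unfolding bounded_pos by auto
  have "E \<subseteq> {z. dist 0 z \<le> (b * 2^n) / 2^n}" using b by auto
  then have "dyadic_index n ` E \<subseteq> dyadic_index n ` {z. dist 0 z \<le> (b * 2^n) / 2^n}" by (rule image_mono)
  moreover have "finite (dyadic_index n ` {z::real^'n. dist 0 z \<le> (b * 2^n) / 2^n})"
    by (rule dyadic_indices_near(1)) (use b in simp)
  ultimately show ?thesis by (rule finite_subset)
qed

lemma diameter_dyadic_cube_le:
  fixes k :: "'n::finite \<Rightarrow> int"
  shows "diameter (dyadic_cube (int n) k) \<le> real CARD('n) / 2^n"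
proof (rule diameter_le)
  fix x y :: "real ^ 'n" assume xy: "x \<in> dyadic_cube (int n) k" "y \<in> dyadic_cube (int n) k"
  have "norm (x - y) \<le> (\<Sum>i\<in>UNIV. \<bar>(x - y) $ i\<bar>)" by (rule norm_le_l1_cart)
  also have "\<dots> \<le> (\<Sum>i\<in>(UNIV::'n set). 1 / 2^n)"
  proof (rule sum_mono)
    fix i
    have "dyadic_index n x i = dyadic_index n y i" using xy by (simp add: mem_dyadic_cube_iff)
    then have "\<lfloor>x $ i * 2^n\<rfloor> = \<lfloor>y $ i * 2^n\<rfloor>" by (simp add: dyadic_index_def)
    then have "\<bar>x $ i * 2^n - y $ i * 2^n\<bar> \<le> 1" by linarith
    then show "\<bar>(x - y) $ i\<bar> \<le> 1 / 2^n"
      unfolding abs_diff_mult_power by (simp add: pos_le_divide_eq)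
  qed
  finally show "norm (x - y) \<le> real CARD('n) / 2^n" by simp
qed simp

section \<open>The packing estimate\<close>

text \<open>
  One point of \<open>E\<close> is chosen in every dyadic cube that meets \<open>E\<close>. Around each of these points the
  support overlaps itself on many levels, by \<open>nonflat_overlaps\<close>, and \<open>overlap_scale_sum_le\<close> with the adapted
  net bounds the number of such points by the mass of a bounded set. The bound is uniform in the finest scale
  \<open>N\<close>.
\<close>
lemma dyadic_count_summable:
  fixes \<mu> :: "(real ^ 'n) measure"
  assumes sets: "sets \<mu> = sets borel" and fin: "\<And>x r. emeasure \<mu> (ball x r) < \<infinity>"
    and C: "0 < C"
    and doubling: "\<And>x r. x \<in> X \<Longrightarrow> 0 < r \<Longrightarrow>
      emeasure \<mu> (ball x (2 * r)) \<le> ennreal C * emeasure \<mu> (ball x r)"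
    and X: "closed X" "connected X" and E: "E \<subseteq> X" "bounded E"
    and r0: "0 < r0" and c: "0 < c" and \<epsilon>: "0 < \<epsilon>" "\<epsilon> \<le> 1"
    and lower: "\<And>z r. z \<in> E \<Longrightarrow> 0 < r \<Longrightarrow> r < r0 \<Longrightarrow> ennreal (c * r) \<le> emeasure \<mu> (ball z r)"
    and nonflat: "\<And>z r L. z \<in> E \<Longrightarrow> 0 < r \<Longrightarrow> r < r0 \<Longrightarrow> affine L \<Longrightarrow> aff_dim L = 1 \<Longrightarrow>
      \<exists>p\<in>X. dist z p < r \<and> \<epsilon> * r \<le> infdist p L"
  shows "summable (\<lambda>n. real (card (dyadic_index n ` E)) / 2^n)"
proof (cases "E = {}")
  case True
  then show ?thesis by simp
next
  case False
  then obtain z0 where z0: "z0 \<in> E" by blast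
  \<comment> \<open>\<open>X\<close> has a second point, so it leaves every sufficiently small ball.\<close>
  obtain z1 where z1: "z1 \<in> X" "z1 \<noteq> z0"
  proof -
    let ?L = "(+) z0 ` span {axis undefined (1::real)}"
    have "aff_dim ?L = 1"
      by (simp add: aff_dim_translation_eq aff_dim_subspace dim_insert)
    moreover have "affine ?L" by (simp add: affine_translation[symmetric] subspace_imp_affine)
    ultimately obtain p where p: "p \<in> X" "\<epsilon> * (r0/2) \<le> infdist p ?L"
      using nonflat[OF z0, of "r0/2"] r0 by auto
    have "z0 + 0 \<in> ?L" by (intro imageI span_zero)
    then have "infdist z0 ?L = 0" by simp
    moreover have "0 < \<epsilon> * (r0/2)" using \<epsilon> r0 by simp
    ultimately have "p \<noteq> z0" using p(2) by force
    with p(1) that show thesis by blast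
  qed
  show ?thesis
  proof (rule nonflat_overlaps[OF \<epsilon>, where 'a="real^'n"])
    fix D :: "(real ^ 'n) set" and \<Lambda> A \<delta> h :: real
    assume D: "finite D" "\<And>e. e \<in> D \<Longrightarrow> norm e \<le> \<Lambda>" "0 < \<Lambda>" and pos: "1 \<le> A" "0 < \<delta>" "0 < h"
      and over: "\<And>X z w r. closed X \<Longrightarrow> connected X \<Longrightarrow> z \<in> X \<Longrightarrow> 0 < r \<Longrightarrow> w \<in> X \<Longrightarrow> A * r < dist z w \<Longrightarrow>
      (\<And>L. affine L \<Longrightarrow> aff_dim L = 1 \<Longrightarrow> \<exists>p\<in>X. dist z p < r \<and> \<epsilon> * r \<le> infdist p L) \<Longrightarrow>
      \<exists>e\<in>D. \<exists>u. \<forall>t\<in>{u..u+h*r}. overlapping_level (\<delta>*r) (X \<inter> cball z (A*r)) e t"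
    \<comment> \<open>With this \<open>\<eta>\<close> a net point within \<open>2 \<rho>(p)\<close> of \<open>p\<close> is within \<open>\<delta>/4\<close> times the scale, which keeps overlapping points apart.\<close>
    define \<eta> where "\<eta> = min (1/2) (\<delta> / (8 * A))"
    have \<eta>: "0 < \<eta>" "\<eta> \<le> 1/2" "\<eta> * A \<le> \<delta> / 8"
    proof -
      show "0 < \<eta>" "\<eta> \<le> 1/2" using pos by (auto simp: \<eta>_def)
      have "\<eta> * A \<le> \<delta> / (8 * A) * A" using pos by (intro mult_right_mono) (auto simp: \<eta>_def)
      then show "\<eta> * A \<le> \<delta> / 8" using pos by simp
    qed
    from adapted_net[OF sets fin C doubling False E(2) lower c \<eta>(1,2), of X r0] obtain C0 where
      C0: "\<And>s \<rho>. 0 < s \<and> s < r0 \<and> \<rho> = (\<lambda>p. \<eta> * max s (infdist p E)) \<Longrightarrow>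
    (\<exists>S. finite S \<and> (\<Sum>x\<in>S. \<rho> x) \<le> C0 \<and>
      (\<forall>p\<in>X. infdist p E < r0 \<longrightarrow> (\<exists>x\<in>S. dist p x \<le> 2 * \<rho> x \<and> dist p x \<le> 2 * \<rho> p)))"
      by blast
    define B where "B = A + \<delta> + \<delta>/2"
    define M where "M = (2 * nat \<lceil>B\<rceil> + 3) ^ CARD('n)"
    obtain a :: nat where "8 * B / (\<delta>/2) < 2^a" using real_arch_pow[of 2] by auto
    then have a: "8 * (A + \<delta> + \<delta>/2) < 2^a * (\<delta>/2)" using pos by (simp add: B_def field_simps)
    \<comment> \<open>At scales finer than \<open>n0\<close> one of \<open>z0\<close>, \<open>z1\<close> is outside the ball around any given point of \<open>E\<close>.\<close>
    define d where "d = min r0 (dist z0 z1 / 2)"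
    have d: "0 < d" using z1 r0 by (simp add: d_def)
    obtain n0 :: nat where n0: "A / d < 2^n0" using real_arch_pow[of 2] by auto
    have An: "A / 2^n < d" if "n0 \<le> n" for n
    proof -
      have "(2::real)^n0 \<le> 2^n" using that by (intro power_increasing) auto
      with n0 have "A / d < 2^n" by linarith
      then show ?thesis using d by (simp add: field_simps)
    qed
    have le_An: "1 / 2^n \<le> A / 2^n" for n using pos by (intro divide_right_mono) auto
    define rep where "rep n k = (SOME x. x \<in> E \<and> dyadic_index n x = k)" for n k
    define Z where "Z n = rep n ` dyadic_index n ` E" for n
    have rep: "rep n k \<in> E \<and> dyadic_index n (rep n k) = k" if "k \<in> dyadic_index n ` E" for n k
      unfolding rep_def by (rule someI_ex) (use that in auto)
    have ZE: "Z n \<subseteq> E" for n using rep by (auto simp: Z_def)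
    have Zfin: "finite (Z n)" for n unfolding Z_def by (intro finite_imageI finite_dyadic_indices E)
    have Zinj: "inj_on (dyadic_index n) (Z n)" for n using rep by (auto simp: Z_def inj_on_def)
    have Zcard: "card (Z n) = card (dyadic_index n ` E)" for n
      unfolding Z_def by (rule card_image) (metis inj_onI rep)
    have mult: "card {z \<in> Z n. dist v z \<le> B / 2^n} \<le> M" for n v
    proof -
      have B0: "0 \<le> B" using pos by (simp add: B_def)
      have "card {z \<in> Z n. dist v z \<le> B / 2^n} = card (dyadic_index n ` {z \<in> Z n. dist v z \<le> B / 2^n})"
        by (rule card_image[symmetric], rule inj_on_subset[OF Zinj]) auto
      also have "\<dots> \<le> card (dyadic_index n ` {z. dist v z \<le> B / 2^n})"
        using dyadic_indices_near(1)[OF B0] by (rule card_mono) auto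
      also have "\<dots> \<le> M" unfolding M_def using dyadic_indices_near(2)[OF B0] .
      finally show ?thesis .
    qed
    define f where "f n = real (card (dyadic_index n ` E)) / 2^n" for n
    define K where "K = card D * (a * M) * (4 * \<Lambda> * C0)"
    have block: "h * (\<Sum>n\<in>{n0..N}. f n) \<le> K" if N: "n0 \<le> N" for N
    proof -
      define \<rho> where "\<rho> = (\<lambda>p. \<eta> * max (1/2^N) (infdist p E))"
      have "1/2^N < r0" using le_An[of N] An[OF N] by (simp add: d_def)
      then obtain S where S: "finite S" "(\<Sum>x\<in>S. \<rho> x) \<le> C0"
        and near: "\<And>p. p \<in> X \<Longrightarrow> infdist p E < r0 \<Longrightarrow> \<exists>x\<in>S. dist p x \<le> 2 * \<rho> x \<and> dist p x \<le> 2 * \<rho> p"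
        using C0[of "1/2^N" \<rho>] by (auto simp: \<rho>_def)
      have "(\<Sum>n\<in>{n0..N}. \<Sum>z\<in>Z n. h/2^n) \<le> card D * (a * M) * (4 * \<Lambda> * (\<Sum>x\<in>S. \<rho> x))"
      proof (rule overlap_scale_sum_le[where X=X and A=A and \<delta>=\<delta>])
        show "\<And>x. x \<in> S \<Longrightarrow> 0 \<le> \<rho> x" using \<eta> by (simp add: \<rho>_def le_max_iff_disj)
        show "card {z \<in> Z n. dist v z \<le> (A + \<delta> + \<delta>/2) / 2^n} \<le> M" for n v
          using mult[of n v] by (simp add: B_def)
        fix n z assume n: "n \<in> {n0..N}" and z: "z \<in> Z n"
        then have zE: "z \<in> E" "z \<in> X" using ZE E by auto
        have And: "A / 2^n < d" using An n by simp
        have "\<exists>w\<in>X. A * (1 / 2^n) < dist z w"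
        proof (rule ccontr)
          assume "\<not> ?thesis"
          then have "dist z z0 \<le> A / 2^n" "dist z z1 \<le> A / 2^n" using z0 z1 E by force+
          then have "dist z0 z1 < 2 * d" using And dist_triangle3[of z0 z1 z] by linarith
          then show False by (simp add: d_def)
        qed
        then obtain w where w: "w \<in> X" "A * (1 / 2^n) < dist z w" by blast
        have "\<exists>e\<in>D. \<exists>u. \<forall>t\<in>{u..u+h*(1/2^n)}. overlapping_level (\<delta>*(1/2^n)) (X \<inter> cball z (A*(1/2^n))) e t"
          by (rule over[OF X zE(2) _ w])
            (use nonflat[OF zE(1), of "1/2^n"] le_An[of n] And in \<open>auto simp: d_def\<close>)
        then show "\<exists>e\<in>D. \<exists>u. \<forall>t\<in>{u..u+h/2^n}. overlapping_level (\<delta>/2^n) (X \<inter> cball z (A/2^n)) e t"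
          by simp
        fix p assume p: "p \<in> X" "dist z p \<le> A/2^n"
        have iE: "infdist p E \<le> A/2^n" using infdist_le[OF zE(1), of p] p(2) by (simp add: dist_commute)
        then obtain x where x: "x \<in> S" "dist p x \<le> 2 * \<rho> x" "dist p x \<le> 2 * \<rho> p"
          using near[OF p(1)] And by (auto simp: d_def)
        have "1 / 2^N \<le> (1::real) / 2^n" using n by (intro divide_left_mono power_increasing) auto
        then have "max (1/2^N) (infdist p E) \<le> A/2^n" using iE le_An[of n] by simp
        then have "\<rho> p \<le> \<eta> * (A/2^n)" unfolding \<rho>_def using \<eta> by (intro mult_left_mono) auto
        also have "\<dots> = (\<eta> * A) / 2^n" by simp
        also have "\<dots> \<le> (\<delta>/8) / 2^n" using \<eta> by (intro divide_right_mono) auto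
        finally have "2 * \<rho> p \<le> \<delta>/4/2^n" by simp
        then show "\<exists>x\<in>S. dist p x \<le> 2 * \<rho> x \<and> dist p x \<le> \<delta>/4/2^n" using x by force
      qed (use D S pos a Zfin in auto)
      also have "\<dots> \<le> K"
        unfolding K_def using D S by (intro mult_left_mono) auto
      finally show ?thesis by (simp add: Zcard f_def sum_distrib_left mult.commute)
    qed
    have f0: "0 \<le> f n" for n by (simp add: f_def)
    have "sum f {..<N} \<le> sum f {..<n0} + K / h" for N
    proof -
      have "sum f {..<N} \<le> sum f ({..<n0} \<union> {n0..N + n0})" using f0 by (intro sum_mono2) auto
      also have "\<dots> = sum f {..<n0} + sum f {n0..N + n0}" by (rule sum.union_disjoint) auto
      also have "sum f {n0..N + n0} \<le> K / h" using block[of "N + n0"] pos by (simp add: field_simps)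
      finally show ?thesis by simp
    qed
    with f0 have "summable f" by (rule summableI_nonneg_bounded)
    then show ?thesis unfolding f_def .
  qed
qed

section \<open>Support, beta numbers and density\<close>

lemma closed_msupport:
  assumes sets: "sets \<mu> = sets borel"
  shows "closed (msupport \<mu>)"
proof -
  have "\<exists>T. open T \<and> x \<in> T \<and> T \<subseteq> - msupport \<mu>" if x: "x \<in> - msupport \<mu>" for x
  proof -
    obtain r where r: "0 < r" "emeasure \<mu> (ball x r) = 0"
      using x by (auto simp: msupport_def)
    have "y \<notin> msupport \<mu>" if y: "y \<in> ball x r" for y
    proof
      assume "y \<in> msupport \<mu>"
      then have pos: "0 < emeasure \<mu> (ball y (r - dist x y))" using y by (auto simp: msupport_def)
      have "ball y (r - dist x y) \<subseteq> ball x r"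
      proof
        fix w assume "w \<in> ball y (r - dist x y)"
        then show "w \<in> ball x r" using dist_triangle[of x w y] by simp
      qed
      then have "emeasure \<mu> (ball y (r - dist x y)) \<le> emeasure \<mu> (ball x r)"
        using sets by (intro emeasure_mono) auto
      with pos r show False by simp
    qed
    with r show ?thesis by (intro exI[of _ "ball x r"]) auto
  qed
  then show ?thesis unfolding closed_def by (subst open_subopen) (intro ballI)
qed

text \<open>
  The complement of the support is covered by the null sets of a countable basis.
\<close>
lemma AE_msupport:
  fixes \<mu> :: "'a::{metric_space, second_countable_topology} measure"
  assumes sets: "sets \<mu> = sets borel"
  shows "AE x in \<mu>. x \<in> msupport \<mu>"
proof -
  obtain B :: "'a set set" where B: "countable B" "topological_basis B"
    using ex_countable_basis by blast
  let ?N = "{U \<in> B. emeasure \<mu> U = 0}"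
  have null: "U \<in> null_sets \<mu>" if "U \<in> ?N" for U
    using that topological_basis_open[OF B(2)] sets by (auto intro!: null_setsI)
  have "countable ?N" by (rule countable_subset[OF _ B(1)]) blast
  then have "(\<Union>U\<in>?N. U) \<in> null_sets \<mu>" using null by (rule null_sets_UN')
  moreover have "{x \<in> space \<mu>. x \<notin> msupport \<mu>} \<subseteq> (\<Union>U\<in>?N. U)"
  proof clarify
    fix x assume "x \<notin> msupport \<mu>"
    then obtain r where r: "0 < r" "emeasure \<mu> (ball x r) = 0" by (auto simp: msupport_def)
    from topological_basisE[OF B(2) open_ball centre_in_ball[THEN iffD2, OF r(1)]]
    obtain U where U: "U \<in> B" "x \<in> U" "U \<subseteq> ball x r" .
    have "emeasure \<mu> U \<le> emeasure \<mu> (ball x r)" using U(3) sets by (intro emeasure_mono) auto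
    with r(2) have "U \<in> ?N" using U(1) by simp
    with U(2) show "x \<in> (\<Union>U\<in>?N. U)" by blast
  qed
  ultimately show ?thesis by (rule AE_I')
qed

text \<open>
  The diameter of the ball is \<open>2 r\<close>, so the integrand of the candidate line \<open>L\<close> is at most
  \<open>\<epsilon>\<^sup>2\<close> almost everywhere on the ball.
\<close>
lemma beta2_le_if_near_line:
  fixes \<mu> :: "(real ^ 'n) measure"
  assumes sets: "sets \<mu> = sets borel" and fin: "emeasure \<mu> (ball x r) < \<infinity>"
    and L: "affine L" "aff_dim L = 1" and r: "0 < r" and \<epsilon>: "0 \<le> \<epsilon>"
    and near: "\<And>p. p \<in> msupport \<mu> \<Longrightarrow> dist x p < r \<Longrightarrow> infdist p L \<le> \<epsilon> * r"
  shows "beta2 \<mu> (ball x r) \<le> \<epsilon>"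
proof -
  let ?B = "ball x r"
  let ?I = "\<lambda>L. (LINT y:?B|\<mu>. (infdist y L / diameter ?B)\<^sup>2) / measure \<mu> ?B"
  have d: "diameter ?B = 2 * r" using r by simp
  have B: "?B \<in> sets \<mu>" using sets by simp
  have nn: "0 \<le> ?I L'" for L'
    unfolding set_lebesgue_integral_def by (intro divide_nonneg_nonneg integral_nonneg_AE) auto
  have "(LINT y:?B|\<mu>. (infdist y L / diameter ?B)\<^sup>2) \<le> (LINT y|\<mu>. indicator ?B y * \<epsilon>\<^sup>2)"
    unfolding set_lebesgue_integral_def
  proof (rule integral_mono_AE')
    show "integrable \<mu> (\<lambda>y. indicator ?B y * \<epsilon>\<^sup>2)"
      using B fin by (intro integrable_mult_left) (auto simp: integrable_indicator_iff)
    show "AE y in \<mu>. indicator ?B y *\<^sub>R (infdist y L / diameter ?B)\<^sup>2 \<le> indicator ?B y * \<epsilon>\<^sup>2"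
      using AE_msupport[OF sets]
    proof eventually_elim
      case (elim y)
      have "(infdist y L / diameter ?B)\<^sup>2 \<le> \<epsilon>\<^sup>2" if "y \<in> ?B"
      proof (rule power_mono)
        have "infdist y L \<le> \<epsilon> * r" using near[OF elim] that by simp
        also have "\<dots> \<le> \<epsilon> * (2 * r)" using \<epsilon> r by (intro mult_left_mono) auto
        finally show "infdist y L / diameter ?B \<le> \<epsilon>" unfolding d using r by (simp add: pos_divide_le_eq)
        show "0 \<le> infdist y L / diameter ?B" unfolding d using r by (simp add: infdist_nonneg)
      qed
      then show ?case by (auto simp: indicator_def)
    qed
  qed (auto simp: indicator_def)
  also have "(LINT y|\<mu>. indicator ?B y * \<epsilon>\<^sup>2) = measure \<mu> ?B * \<epsilon>\<^sup>2"
    using B by simp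
  finally have "?I L \<le> measure \<mu> ?B * \<epsilon>\<^sup>2 / measure \<mu> ?B" by (intro divide_right_mono) auto
  also have "\<dots> \<le> \<epsilon>\<^sup>2" by (cases "measure \<mu> ?B = 0") auto
  finally have "?I L \<le> \<epsilon>\<^sup>2" .
  moreover have "(INF L\<in>{L. affine L \<and> aff_dim L = 1}. ?I L) \<le> ?I L"
    using L nn by (intro cINF_lower bdd_belowI[of _ 0]) auto
  ultimately have "sqrt (INF L\<in>{L. affine L \<and> aff_dim L = 1}. ?I L) \<le> sqrt (\<epsilon>\<^sup>2)"
    by (intro real_sqrt_le_mono) linarith
  then show ?thesis unfolding beta2_def using \<epsilon> by simp
qed

lemma eventually_nonflat:
  fixes \<mu> :: "(real ^ 'n) measure"
  assumes sets: "sets \<mu> = sets borel" and fin: "\<And>r. emeasure \<mu> (ball x r) < \<infinity>"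
    and lim: "Liminf (at_right 0) (\<lambda>r. ereal (beta2 \<mu> (ball x r))) > 0"
  shows "\<exists>\<epsilon>>0. \<exists>b>0. \<forall>r L. 0 < r \<and> r < b \<and> affine L \<and> aff_dim L = 1 \<longrightarrow>
    (\<exists>p\<in>msupport \<mu>. dist x p < r \<and> \<epsilon> * r \<le> infdist p L)"
proof -
  from ereal_dense2[OF lim] obtain \<epsilon>
    where \<epsilon>: "0 < ereal \<epsilon>" "ereal \<epsilon> < Liminf (at_right 0) (\<lambda>r. ereal (beta2 \<mu> (ball x r)))"
    by (elim exE conjE)
  have "eventually (\<lambda>r. ereal \<epsilon> < ereal (beta2 \<mu> (ball x r))) (at_right 0)"
    using \<epsilon>(2) by (rule less_LiminfD)
  then obtain b where b0: "0 < b" and "\<forall>r>0. r < b \<longrightarrow> ereal \<epsilon> < ereal (beta2 \<mu> (ball x r))"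
    unfolding eventually_at_right_field by (elim exE conjE)
  then have b: "\<epsilon> < beta2 \<mu> (ball x r)" if "0 < r" "r < b" for r using that by simp
  have \<epsilon>0: "0 < \<epsilon>" using \<epsilon>(1) by simp
  show ?thesis
  proof (rule exI[of _ \<epsilon>], rule conjI[OF \<epsilon>0], rule exI[of _ b], rule conjI[OF b0], intro allI impI)
    fix r and L :: "(real ^ 'n) set"
    assume "0 < r \<and> r < b \<and> affine L \<and> aff_dim L = 1"
    then have r: "0 < r" "r < b" and L: "affine L" "aff_dim L = 1" by auto
    show "\<exists>p\<in>msupport \<mu>. dist x p < r \<and> \<epsilon> * r \<le> infdist p L"
    proof (rule ccontr)
      assume "\<not> ?thesis"
      then have "\<forall>p\<in>msupport \<mu>. dist x p < r \<longrightarrow> infdist p L < \<epsilon> * r" by (meson not_le)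
      then have "\<And>p. p \<in> msupport \<mu> \<Longrightarrow> dist x p < r \<Longrightarrow> infdist p L \<le> \<epsilon> * r" by (blast intro: less_imp_le)
      then have "beta2 \<mu> (ball x r) \<le> \<epsilon>"
        using \<epsilon>(1) by (intro beta2_le_if_near_line[OF sets fin L r(1)]) auto
      with b[OF r] show False by simp
    qed
  qed
qed

lemma eventually_linear_mass:
  fixes \<mu> :: "(real ^ 'n) measure"
  assumes fin: "\<And>r. emeasure \<mu> (ball x r) < \<infinity>" and dens: "lower_density1 \<mu> x > 0"
  shows "\<exists>c>0. \<exists>b>0. \<forall>r. 0 < r \<and> r < b \<longrightarrow> ennreal (c * r) \<le> emeasure \<mu> (ball x r)"
proof -
  obtain c' where c': "0 < c'" "c' < lower_density1 \<mu> x" using dense[OF dens] by blast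
  then have "c' \<noteq> top" by auto
  then obtain c where c: "c' = ennreal c" "0 \<le> c" by (cases c') auto
  then have c0: "0 < c" using c'(1) by simp
  have "eventually (\<lambda>r. ennreal c < emeasure \<mu> (ball x r) / ennreal r) (at_right 0)"
    using c' unfolding lower_density1_def c(1) by (intro less_LiminfD)
  then obtain b where b: "0 < b" "\<forall>r>0. r < b \<longrightarrow> ennreal c < emeasure \<mu> (ball x r) / ennreal r"
    unfolding eventually_at_right_field by (elim exE conjE)
  show ?thesis
  proof (rule exI[of _ c], rule conjI[OF c0], rule exI[of _ b], rule conjI[OF b(1)], intro allI impI)
    fix r assume "0 < r \<and> r < b"
    then have r: "0 < r" "r < b" by auto
    have e: "emeasure \<mu> (ball x r) = ennreal (measure \<mu> (ball x r))"
      using fin[of r] by (intro emeasure_eq_ennreal_measure) auto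
    have "ennreal c < emeasure \<mu> (ball x r) / ennreal r" using b(2) r by blast
    then have "ennreal c < ennreal (measure \<mu> (ball x r) / r)"
      unfolding e using r by (simp add: divide_ennreal)
    then have "c * r < measure \<mu> (ball x r)"
      using c(2) r by (subst (asm) ennreal_less_iff) (auto simp: pos_less_divide_eq)
    then show "ennreal (c * r) \<le> emeasure \<mu> (ball x r)" unfolding e by (intro ennreal_leI) simp
  qed
qed

section \<open>Almost everywhere finiteness of the dyadic sum\<close>

lemma small_dyadic_cubes_at_eq:
  "small_dyadic_cubes_at x = range (\<lambda>n. dyadic_cube (int n) (dyadic_index n x))"
proof (intro equalityI subsetI)
  fix Q assume "Q \<in> small_dyadic_cubes_at x"
  then obtain n k where Q: "Q = dyadic_cube n k" "(2::real) powi (- n) \<le> 1" "x \<in> Q"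
    unfolding small_dyadic_cubes_at_def mem_Collect_eq by (elim exE conjE)
  have "0 \<le> n"
  proof (rule ccontr)
    assume neg: "\<not> 0 \<le> n"
    then have "(2::real) powi (- n) = 2 ^ nat (- n)" by (simp add: power_int_def)
    moreover have "(1::real) < 2 ^ nat (- n)" using neg by (intro one_less_power) auto
    ultimately show False using Q(2) by simp
  qed
  then have n: "n = int (nat n)" by simp
  have "x \<in> dyadic_cube (int (nat n)) k" using Q(1,3) n by metis
  then have "k = dyadic_index (nat n) x" unfolding mem_dyadic_cube_iff .
  then have "Q = dyadic_cube (int (nat n)) (dyadic_index (nat n) x)" using Q(1) n by metis
  then show "Q \<in> range (\<lambda>n. dyadic_cube (int n) (dyadic_index n x))" by (rule range_eqI)
next
  fix Q assume "Q \<in> range (\<lambda>n. dyadic_cube (int n) (dyadic_index n x))"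
  then obtain m where Q: "Q = dyadic_cube (int m) (dyadic_index m x)" by (elim rangeE)
  have "(2::real) powi (- int m) \<le> 1"
    by (simp add: power_int_minus divide_simps)
  moreover have "x \<in> Q" unfolding Q by (simp add: mem_dyadic_cube_iff)
  ultimately show "Q \<in> small_dyadic_cubes_at x"
    unfolding small_dyadic_cubes_at_def using Q by blast
qed

text \<open>
  An inequality suffices below, so \<open>q\<close> need not be injective: repeated values only increase the
  right-hand side.
\<close>
lemma infsum_range_le_suminf:
  fixes f :: "'a \<Rightarrow> ennreal" and q :: "nat \<Rightarrow> 'a"
  shows "infsum f (range q) \<le> (\<Sum>n. f (q n))"
proof (rule infsum_le_finite_sums)
  show "f summable_on range q" by (rule nonneg_summable_on_complete) simp
  fix F assume F: "finite F" "F \<subseteq> range q"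
  from F(2) obtain U where U: "inj_on q U" "F = q ` U" unfolding subset_image_inj by blast
  with F(1) have finU: "finite U" using finite_imageD by blast
  have "sum f F = (\<Sum>n\<in>U. f (q n))" using U by (simp add: sum.reindex)
  also have "\<dots> \<le> (\<Sum>n. f (q n))" using finU by (intro sum_le_suminf) auto
  finally show "sum f F \<le> (\<Sum>n. f (q n))" .
qed

lemma dyadic_cube_measurable: "dyadic_cube n (k :: 'n::finite \<Rightarrow> int) \<in> sets borel"
  unfolding dyadic_cube_def by measurable

text \<open>
  The function \<open>g\<close> sums over the cubes that meet \<open>E\<close>, so its integral is at most the sum of the
  bounds on their diameters. At points of \<open>E\<close> it dominates the dyadic sum, because every cube that contains such a point
  meets \<open>E\<close>.
\<close>
lemma AE_dyadic_sum_finite: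
  fixes \<mu> :: "(real ^ 'n) measure"
  assumes sets: "sets \<mu> = sets borel" and finb: "\<And>x r. emeasure \<mu> (ball x r) < \<infinity>"
    and E: "bounded E" "summable (\<lambda>n. real (card (dyadic_index n ` E)) / 2^n)"
  shows "AE x in \<mu>. x \<in> E \<longrightarrow>
    (\<Sum>\<^sub>\<infinity>Q\<in>small_dyadic_cubes_at x. ennreal (diameter Q) / emeasure \<mu> Q) < \<infinity>"
proof -
  let ?Q = "\<lambda>n k. dyadic_cube (int n) k :: (real ^ 'n) set"
  let ?d = "real CARD('n)"
  have Qs: "?Q n k \<in> sets \<mu>" for n k using dyadic_cube_measurable sets by simp
  define I where "I n = dyadic_index n ` E" for n
  have finI: "finite (I n)" for n unfolding I_def by (rule finite_dyadic_indices[OF E(1)])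
  define g where "g x = (\<Sum>n. \<Sum>k\<in>I n. ennreal (?d / 2^n) / emeasure \<mu> (?Q n k) * indicator (?Q n k) x)" for x
  have g_meas: "g \<in> borel_measurable \<mu>" unfolding g_def
    by (intro borel_measurable_suminf_order borel_measurable_sum borel_measurable_times_ennreal
        borel_measurable_const borel_measurable_indicator Qs)
  have "(\<integral>\<^sup>+x. g x \<partial>\<mu>) = (\<Sum>n. \<Sum>k\<in>I n. ennreal (?d / 2^n) / emeasure \<mu> (?Q n k) * emeasure \<mu> (?Q n k))"
    unfolding g_def using Qs
    by (simp add: nn_integral_suminf nn_integral_sum nn_integral_cmult_indicator)
  also have "\<dots> \<le> (\<Sum>n. ennreal (?d * (real (card (I n)) / 2^n)))"
  proof (intro suminf_le allI summableI)
    fix n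
    have "a / b * b \<le> a" for a b :: ennreal
      by (cases "b = 0 \<or> b = top") (auto simp: ennreal_divide_times ennreal_divide_self less_top)
    then have "(\<Sum>k\<in>I n. ennreal (?d / 2^n) / emeasure \<mu> (?Q n k) * emeasure \<mu> (?Q n k)) \<le> (\<Sum>k\<in>I n. ennreal (?d / 2^n))"
      by (intro sum_mono)
    also have "\<dots> = ennreal (?d * (real (card (I n)) / 2^n))"
      by (simp add: ennreal_of_nat_eq_real_of_nat ennreal_mult[symmetric] mult_ac)
    finally show "(\<Sum>k\<in>I n. ennreal (?d / 2^n) / emeasure \<mu> (?Q n k) * emeasure \<mu> (?Q n k)) \<le> \<dots>" .
  qed
  also have "\<dots> = ennreal (\<Sum>n. ?d * (real (card (I n)) / 2^n))"
    using summable_mult[OF E(2), of ?d] unfolding I_def by (intro suminf_ennreal2) auto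
  also have "\<dots> < \<infinity>" by simp
  finally have "(\<integral>\<^sup>+x. g x \<partial>\<mu>) \<noteq> \<infinity>" by simp
  then have gfin: "AE x in \<mu>. g x \<noteq> \<infinity>" using g_meas by (intro nn_integral_PInf_AE)
  have "AE x in \<mu>. \<forall>n k. emeasure \<mu> (?Q n k) = 0 \<longrightarrow> x \<notin> ?Q n k"
    unfolding AE_all_countable
  proof (intro allI)
    fix n k
    show "AE x in \<mu>. emeasure \<mu> (?Q n k) = 0 \<longrightarrow> x \<notin> ?Q n k"
      using Qs[of n k] by (cases "emeasure \<mu> (?Q n k) = 0") (auto intro!: AE_not_in)
  qed
  with gfin show ?thesis
  proof eventually_elim
    case (elim x)
    show ?case
    proof
      assume x: "x \<in> E"
      let ?f = "\<lambda>Q. ennreal (diameter Q) / emeasure \<mu> Q"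
      have "(\<Sum>\<^sub>\<infinity>Q\<in>small_dyadic_cubes_at x. ?f Q) \<le> (\<Sum>n. ?f (?Q n (dyadic_index n x)))"
        unfolding small_dyadic_cubes_at_eq by (rule infsum_range_le_suminf)
      also have "\<dots> \<le> g x" unfolding g_def
      proof (intro suminf_le allI summableI)
        fix n
        let ?k = "dyadic_index n x"
        have xQ: "x \<in> ?Q n ?k" by (simp add: mem_dyadic_cube_iff)
        have "?f (?Q n ?k) \<le> ennreal (?d / 2^n) / emeasure \<mu> (?Q n ?k) * indicator (?Q n ?k) x"
          using xQ diameter_dyadic_cube_le[of n ?k]
          by (simp add: divide_right_mono_ennreal ennreal_leI)
        also have "\<dots> \<le> (\<Sum>k\<in>I n. ennreal (?d / 2^n) / emeasure \<mu> (?Q n k) * indicator (?Q n k) x)"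
          by (rule member_le_sum) (use x finI in \<open>auto simp: I_def\<close>)
        finally show "?f (?Q n ?k) \<le> \<dots>" .
      qed
      also have "\<dots> < \<infinity>" using elim(1) by (simp add: less_top)
      finally show "(\<Sum>\<^sub>\<infinity>Q\<in>small_dyadic_cubes_at x. ?f Q) < \<infinity>" .
    qed
  qed
qed

text \<open>
  The sets \<open>E m\<close> below exhaust the support up to a null set, because all constants in the hypotheses
  at a given point are positive and so exceed \<open>1 / (m + 1)\<close> for some \<open>m\<close>.
\<close>

theorem corollary1p4:
  fixes \<mu> :: "(real ^ 'n) measure"
  assumes "doubling_measure \<mu>"
    and "connected (msupport \<mu>)"
    and "AE x in \<mu>. Liminf (at_right 0) (\<lambda>r. ereal (beta2 \<mu> (ball x r))) > 0"
    and "AE x in \<mu>. lower_density1 \<mu> x > 0"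
  shows "AE x in \<mu>.
           (\<Sum>\<^sub>\<infinity>Q\<in>small_dyadic_cubes_at x. ennreal (diameter Q) / emeasure \<mu> Q) < \<infinity>"
proof -
  let ?X = "msupport \<mu>"
  from assms(1) obtain C where sets: "sets \<mu> = sets borel" and fin: "\<And>x r. emeasure \<mu> (ball x r) < \<infinity>"
    and C: "0 < C" and doubling: "\<And>x r. x \<in> ?X \<Longrightarrow> 0 < r \<Longrightarrow>
      emeasure \<mu> (ball x (2 * r)) \<le> ennreal C * emeasure \<mu> (ball x r)"
    unfolding doubling_measure_def by blast
  define \<delta> where "\<delta> m = 1 / real (Suc m)" for m
  have \<delta>: "0 < \<delta> m" "\<delta> m \<le> 1" for m by (auto simp: \<delta>_def)
  define E where "E m = {x \<in> ?X. norm x \<le> real m \<and> (\<forall>r. 0 < r \<and> r < \<delta> m \<longrightarrow>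
      ennreal (\<delta> m * r) \<le> emeasure \<mu> (ball x r) \<and>
      (\<forall>L. affine L \<and> aff_dim L = 1 \<longrightarrow> (\<exists>p\<in>?X. dist x p < r \<and> \<delta> m * r \<le> infdist p L)))}" for m
  have "AE x in \<mu>. x \<in> E m \<longrightarrow>
      (\<Sum>\<^sub>\<infinity>Q\<in>small_dyadic_cubes_at x. ennreal (diameter Q) / emeasure \<mu> Q) < \<infinity>" for m
  proof (rule AE_dyadic_sum_finite[OF sets fin])
    show bd: "bounded (E m)" unfolding bounded_iff by (intro exI[of _ "real m"]) (auto simp: E_def)
    show "summable (\<lambda>n. real (card (dyadic_index n ` E m)) / 2^n)"
      by (rule dyadic_count_summable[OF sets fin C doubling closed_msupport[OF sets] assms(2) _ bd \<delta>(1) \<delta>(1) \<delta>])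
        (auto simp: E_def)
  qed
  then have "AE x in \<mu>. \<forall>m. x \<in> E m \<longrightarrow>
      (\<Sum>\<^sub>\<infinity>Q\<in>small_dyadic_cubes_at x. ennreal (diameter Q) / emeasure \<mu> Q) < \<infinity>"
    unfolding AE_all_countable by blast
  with AE_msupport[OF sets] assms(3,4) show ?thesis
  proof eventually_elim
    case (elim x)
    from eventually_nonflat[OF sets fin elim(2)] obtain \<epsilon> b where \<epsilon>: "0 < \<epsilon>" "0 < b"
      and nonflat: "\<forall>r L. 0 < r \<and> r < b \<and> affine L \<and> aff_dim L = 1 \<longrightarrow>
        (\<exists>p\<in>?X. dist x p < r \<and> \<epsilon> * r \<le> infdist p L)"
      by (elim exE conjE)
    from eventually_linear_mass[OF fin elim(3)] obtain c b' where c: "0 < c" "0 < b'"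
      and mass: "\<forall>r. 0 < r \<and> r < b' \<longrightarrow> ennreal (c * r) \<le> emeasure \<mu> (ball x r)"
      by (elim exE conjE)
    define s where "s = min (min \<epsilon> b) (min c b')"
    have s: "0 < s" using \<epsilon> c by (simp add: s_def)
    obtain m1 :: nat where m1: "1 / s < real m1" using reals_Archimedean2 by blast
    obtain m2 :: nat where m2: "norm x \<le> real m2" using real_arch_simple by blast
    define m where "m = max m1 m2"
    have "1 / s < real (Suc m)" using m1 by (simp add: m_def)
    then have "\<delta> m < s" using s by (simp add: \<delta>_def field_simps)
    then have le: "\<delta> m < \<epsilon>" "\<delta> m < b" "\<delta> m < c" "\<delta> m < b'" by (auto simp: s_def)
    have "x \<in> E m"
      unfolding E_def
    proof (intro CollectI conjI allI impI)
      show "x \<in> ?X" using elim(1) .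
      show "norm x \<le> real m" using m2 by (simp add: m_def)
      fix r assume r: "0 < r \<and> r < \<delta> m"
      have "ennreal (\<delta> m * r) \<le> ennreal (c * r)" using le r by (intro ennreal_leI mult_right_mono) auto
      also have "\<dots> \<le> emeasure \<mu> (ball x r)" using r le mass by auto
      finally show "ennreal (\<delta> m * r) \<le> emeasure \<mu> (ball x r)" .
      fix L :: "(real ^ 'n) set" assume L: "affine L \<and> aff_dim L = 1"
      then obtain p where p: "p \<in> ?X" "dist x p < r" "\<epsilon> * r \<le> infdist p L"
        using nonflat r le by (meson less_trans)
      have "\<delta> m * r \<le> \<epsilon> * r" using le r by (intro mult_right_mono) auto
      with p show "\<exists>p\<in>?X. dist x p < r \<and> \<delta> m * r \<le> infdist p L" by force
    qed
    with elim(4) show ?case by blast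
  qed
qed

end
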